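(* Let $\mathrm{d}\sigma^2$ be a conformal metric of Gauss curvature zero on the punctured disk $\Delta^*=\{\omega\in\mathbb{C}\mid 0<|\omega|<1\}$. Suppose that the $\mathrm{d}\sigma^2$-area near the origin $\omega=0$ satisfies a polynomial growth condition: there exist constants $0<R<1$, $M>0$ and $N\ge 0$ (independent of $r$) such that $$\mathrm{Area}\Big(\Delta\big(0,\tfrac1r,R\big)\Big)\le M r^{N}\qquad\text{for all } r>\tfrac1R,$$ where $\Delta(0,\frac1r,R)=\{\omega\in\mathbb{C}\mid \frac1r<|\omega|<R\}$ and $\mathrm{Area}$ denotes the $\mathrm{d}\sigma^2$-area. Then for some $\varepsilon>0$ there exists a holomorphic coordinate transformation $\omega\mapsto z(\omega)$ on $U_\varepsilon=\{\omega\in\mathbb{C}\mid|\omega|<\varepsilon\}$ with $z(0)=0$ such that on $U_\varepsilon$ (away from the origin) the metric can be written in one of the following three forms: (1) $\mathrm{d}\sigma^2|_{U_\varepsilon}=(\beta+1)^2|z|^{2\beta}|\mathrm{d}z|^2$, with $\beta\in\mathbb{R}\setminus\{-1\}$; (2) $\mathrm{d}\sigma^2|_{U_\varepsilon}=c^2|z|^{-2}|\mathrm{d}z|^2$, with $c>0$; (3) $\mathrm{d}\sigma^2|_{U_\varepsilon}=\left|\dfrac{\nu}{z}-\dfrac{n}{z^{n+1}}\right|^2|\mathrm{d}z|^2$, with $\nu>0$ and $n\in\mathbb{Z}$, $n\ge1$. The constants $\beta$, $c$, $n$, $\nu$ above are all unique. Furthermore, the coordinate $z$ is unique up to a rotation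 $z\mapsto\lambda z$, $|\lambda|=1$, in form (1) when $\beta\in((-\infty,-1)\setminus\mathbb{Z})\cup(-1,+\infty)$, and is unique up to a scalar $z\mapsto \mathrm{p}z$, $\mathrm{p}\in\mathbb{C}^*=\mathbb{C}\setminus\{0\}$, in form (2).
   Context: A conformal metric on a Riemann surface is a Riemannian metric which in any local holomorphic coordinate $w$ has the form $e^{2\varphi}|\mathrm{d}w|^2$ with $\varphi$ a smooth real function. On $\Delta^*$ this means $\mathrm{d}\sigma^2=e^{2\varphi(\omega)}|\mathrm{d}\omega|^2$, and the $\mathrm{d}\sigma^2$-area of a region $D\subset\Delta^*$ is $\iint_D e^{2\varphi}\,\mathrm{d}x\,\mathrm{d}y$, $\omega=x+\mathrm{i}y$. A holomorphic coordinate transformation $\omega\mapsto z(\omega)$ on $U_\varepsilon$ with $z(0)=0$ is a biholomorphic map from $U_\varepsilon$ onto an open neighborhood of $0$ in $\mathbb{C}$ fixing the origin. Writing the metric in terms of $z$ means $|\mathrm{d}z|^2=|z'(\omega)|^2|\mathrm{d}\omega|^2$. Uniqueness of constants and of coordinates is understood among all origin-preserving holomorphic coordinates near the origin in which the metric takes the given form (after shrinking $\varepsilon$ if necessary). *)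

theory Defs
  imports "HOL-Complex_Analysis.Complex_Analysis"
begin

definition punctured_disk :: "complex set" where
  "punctured_disk = {w. 0 < cmod w \<and> cmod w < 1}"

text \<open>\<open>Ck k f S\<close>, for open \<open>S\<close>: the partial derivatives of \<open>f\<close> of order up to \<open>k\<close> exist and are
  continuous on \<open>S\<close>.\<close>

fun Ck :: "nat \<Rightarrow> (complex \<Rightarrow> real) \<Rightarrow> complex set \<Rightarrow> bool" where
  "Ck 0 f S \<longleftrightarrow> continuous_on S f"
| "Ck (Suc k) f S \<longleftrightarrow> (\<forall>w\<in>S. f differentiable (at w)) \<and>
     (\<forall>v. Ck k (\<lambda>w. frechet_derivative f (at w) v) S)"

definition smooth :: "(complex \<Rightarrow> real) \<Rightarrow> complex set \<Rightarrow> bool" where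
  "smooth f S \<longleftrightarrow> (\<forall>k. Ck k f S)"

text \<open>A conformal metric \<open>e\<^bsup>2\<phi>\<^esup> |d\<omega>|\<^sup>2\<close> on the punctured disk is represented throughout by its
  exponent \<open>\<phi>\<close>; the values of \<open>\<phi>\<close> outside the punctured disk are irrelevant.\<close>

definition conformal_metric :: "(complex \<Rightarrow> real) \<Rightarrow> bool" where
  "conformal_metric \<phi> \<longleftrightarrow> smooth \<phi> punctured_disk"

definition partial :: "complex \<Rightarrow> (complex \<Rightarrow> real) \<Rightarrow> complex \<Rightarrow> real" where
  "partial v f w = frechet_derivative f (at w) v"

definition laplacian :: "(complex \<Rightarrow> real) \<Rightarrow> complex \<Rightarrow> real" where
  "laplacian f w = partial 1 (partial 1 f) w + partial \<i> (partial \<i> f) w"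

text \<open>In a conformal coordinate the Gauss curvature is \<open>K = - e\<^bsup>-2\<phi>\<^esup> \<Delta>\<phi>\<close>.\<close>

definition gauss_curvature :: "(complex \<Rightarrow> real) \<Rightarrow> complex \<Rightarrow> real" where
  "gauss_curvature \<phi> w = - exp (- 2 * \<phi> w) * laplacian \<phi> w"

definition area :: "(complex \<Rightarrow> real) \<Rightarrow> complex set \<Rightarrow> ennreal" where
  "area \<phi> D = (\<integral>\<^sup>+ w\<in>D. ennreal (exp (2 * \<phi> w)) \<partial>lborel)"

definition annulus :: "real \<Rightarrow> real \<Rightarrow> complex set" where
  "annulus a b = {w. a < cmod w \<and> cmod w < b}"

definition coordinate_change :: "real \<Rightarrow> (complex \<Rightarrow> complex) \<Rightarrow> bool" where
  "coordinate_change \<epsilon> z \<longleftrightarrow>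
     z holomorphic_on ball 0 \<epsilon> \<and> z 0 = 0 \<and> open (z ` ball 0 \<epsilon>) \<and>
     (\<exists>g. g holomorphic_on (z ` ball 0 \<epsilon>) \<and> (\<forall>w\<in>ball 0 \<epsilon>. g (z w) = w))"

text \<open>The metric equals \<open>\<rho>(z) |dz|\<^sup>2\<close> on the punctured disk of radius \<open>\<epsilon>\<close>. The bound \<open>\<epsilon> \<le> 1\<close> keeps
  this disk inside the domain of the metric.\<close>

definition has_form ::
  "(complex \<Rightarrow> real) \<Rightarrow> (complex \<Rightarrow> real) \<Rightarrow> real \<Rightarrow> (complex \<Rightarrow> complex) \<Rightarrow> bool" where
  "has_form \<phi> \<rho> \<epsilon> z \<longleftrightarrow>
     0 < \<epsilon> \<and> \<epsilon> \<le> 1 \<and> coordinate_change \<epsilon> z \<and>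
     (\<forall>w\<in>ball 0 \<epsilon> - {0}. exp (2 * \<phi> w) = \<rho> (z w) * (cmod (deriv z w))\<^sup>2)"

definition form1 :: "(complex \<Rightarrow> real) \<Rightarrow> real \<Rightarrow> real \<Rightarrow> (complex \<Rightarrow> complex) \<Rightarrow> bool" where
  "form1 \<phi> \<beta> \<epsilon> z \<longleftrightarrow> \<beta> \<noteq> -1 \<and>
     has_form \<phi> (\<lambda>\<zeta>. (\<beta> + 1)\<^sup>2 * cmod \<zeta> powr (2 * \<beta>)) \<epsilon> z"

definition form2 :: "(complex \<Rightarrow> real) \<Rightarrow> real \<Rightarrow> real \<Rightarrow> (complex \<Rightarrow> complex) \<Rightarrow> bool" where
  "form2 \<phi> c \<epsilon> z \<longleftrightarrow> c > 0 \<and>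
     has_form \<phi> (\<lambda>\<zeta>. c\<^sup>2 * cmod \<zeta> powi (-2)) \<epsilon> z"

definition form3 :: "(complex \<Rightarrow> real) \<Rightarrow> real \<Rightarrow> nat \<Rightarrow> real \<Rightarrow> (complex \<Rightarrow> complex) \<Rightarrow> bool" where
  "form3 \<phi> \<nu> n \<epsilon> z \<longleftrightarrow> \<nu> > 0 \<and> n \<ge> 1 \<and>
     has_form \<phi> (\<lambda>\<zeta>. (cmod (of_real \<nu> / \<zeta> - of_nat n / \<zeta> ^ (n + 1)))\<^sup>2) \<epsilon> z"

end

theory Submission
  imports Defs
begin

text \<open>
  Zero curvature means that \<open>\<phi>\<close> is harmonic, so on a simply connected set \<open>\<phi>\<close> is the real part of a
  holomorphic function. On the punctured disk one first lifts \<open>\<phi>\<close> along \<open>exp\<close> to a half plane; going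
  once around the origin changes the holomorphic function only by an imaginary constant, and this
  monodromy is absorbed by a real power of \<open>|\<omega>|\<close>. Hence \<open>e\<^bsup>\<phi>\<^esup> = |\<omega>|\<^bsup>\<kappa>\<^esup> |U|\<close> with \<open>U\<close> holomorphic
  without zeros on the punctured disk (\<open>flat_metric_modulus\<close>).

  The area mean value inequality turns the growth of the area into a polynomial pointwise bound on
  \<open>U\<close> (\<open>area_growth_imp_bounded\<close>). So \<open>U\<close> has no essential singularity, and splitting off a power of
  \<open>\<omega>\<close> gives \<open>e\<^bsup>\<phi>\<^esup> = |\<omega>|\<^bsup>s\<^esup> |u|\<close> near the origin, with \<open>s\<close> real and \<open>u\<close> holomorphic, \<open>u(0) \<noteq> 0\<close>
  (\<open>bounded_modulus_imp_flat_density\<close>). In this representation \<open>s\<close> is determined by the metric, and \<open>u\<close>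
  is determined up to a unimodular constant (\<open>flat_density_unique\<close>). The metric is thus the square of
  the modulus of the multivalued 1-form \<open>\<omega>\<^sup>s u d\<omega>\<close>, and the theorem becomes the classification of
  such forms up to a unimodular factor and a change of coordinate.

  A coordinate fixing the origin is \<open>z = \<omega> e\<^sup>a\<close> with \<open>a\<close> holomorphic. With \<open>\<gamma> = s + 1\<close> the form
  \<open>\<omega>\<^sup>s u d\<omega>\<close> has a primitive \<open>\<omega>\<^sup>\<gamma> q\<close> exactly if \<open>\<gamma> q + \<omega> q' = u\<close>. The operator on the left
  multiplies the \<open>k\<close>-th Taylor coefficient by \<open>\<gamma> + k\<close>, so the equation can be solved unless
  \<open>\<gamma> = -n\<close> for some \<open>n \<ge> 0\<close> while the \<open>n\<close>-th coefficient of \<open>u\<close>, the residue of the form, does not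
  vanish (\<open>fps_nth_euler\<close>, \<open>euler_solvable\<close>). This gives the three cases. If \<open>\<gamma> \<noteq> 0\<close> and there is a
  primitive, then \<open>z\<^sup>\<gamma>\<close> is taken to be that primitive, which is \<open>form1\<close>. If \<open>\<gamma> = 0\<close>, the form has a
  simple pole with residue \<open>u(0)\<close> and can be written \<open>u(0) dz/z\<close>, which is \<open>form2\<close>. If \<open>\<gamma> = -n\<close>
  with \<open>n \<ge> 1\<close> and the residue is not zero, it can be rotated to some \<open>\<nu> > 0\<close>, and \<open>z\<close> has to match
  both the pole and the logarithm in the primitive. This is an implicit equation for \<open>a\<close>, solved by
  contraction (\<open>holomorphic_exp_implicit\<close>), and leads to \<open>form3\<close>.

  Uniqueness is read off from the same data. The exponent \<open>s\<close> gives \<open>\<beta> = s\<close> and \<open>n = - s - 1\<close>; the constants \<open>c\<close> and \<open>\<nu>\<close> are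
  moduli of residues. Two coordinates in \<open>form1\<close> give \<open>q\<close> and \<open>p\<close> with
  \<open>\<gamma> (p - l q) + \<omega> (p - l q)' = 0\<close>, which forces \<open>p = l q\<close> as long as \<open>\<gamma> + k \<noteq> 0\<close> for
  all \<open>k \<ge> 0\<close>; this is the condition on \<open>\<beta>\<close> in the theorem.
\<close>

section \<open>A flat metric as the modulus of a holomorphic function\<close>

lemma has_derivative_frechet_complex:
  fixes f :: "complex \<Rightarrow> real"
  assumes "f differentiable (at w)"
  shows "(f has_derivative (\<lambda>h. Re h * partial 1 f w + Im h * partial \<i> f w)) (at w)"
proof -
  have D: "(f has_derivative frechet_derivative f (at w)) (at w)"
    using assms frechet_derivative_works by blast
  then interpret bounded_linear "frechet_derivative f (at w)" by (rule has_derivative_bounded_linear)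
  have "frechet_derivative f (at w) h = Re h * partial 1 f w + Im h * partial \<i> f w" for h
  proof -
    have h: "h = Re h *\<^sub>R 1 + Im h *\<^sub>R \<i>" by (simp add: complex_eq_iff)
    have "frechet_derivative f (at w) (Re h *\<^sub>R 1 + Im h *\<^sub>R \<i>) =
        Re h * partial 1 f w + Im h * partial \<i> f w"
      by (simp only: add scaleR partial_def real_scaleR_def)
    thus ?thesis by (simp only: h[symmetric])
  qed
  hence "frechet_derivative f (at w) = (\<lambda>h. Re h * partial 1 f w + Im h * partial \<i> f w)" by blast
  with D show ?thesis by simp
qed

lemma has_real_derivative_along_line:
  fixes f :: "complex \<Rightarrow> real"
  assumes "f differentiable (at (p + s *\<^sub>R v))"
  shows "((\<lambda>s. f (p + s *\<^sub>R v)) has_real_derivative partial v f (p + s *\<^sub>R v)) (at s)"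
proof -
  have D: "(f has_derivative frechet_derivative f (at (p + s *\<^sub>R v))) (at (p + s *\<^sub>R v))"
    using assms frechet_derivative_works by blast
  have "((\<lambda>s. p + s *\<^sub>R v) has_derivative (\<lambda>h. h *\<^sub>R v)) (at s)"
    by (auto intro!: derivative_eq_intros)
  from has_derivative_compose[OF this D]
  have "((\<lambda>s. f (p + s *\<^sub>R v)) has_derivative
      (\<lambda>h. frechet_derivative f (at (p + s *\<^sub>R v)) (h *\<^sub>R v))) (at s)" .
  also have "(\<lambda>h. frechet_derivative f (at (p + s *\<^sub>R v)) (h *\<^sub>R v)) =
      (*) (partial v f (p + s *\<^sub>R v))"
    using linear_scale[OF has_derivative_linear[OF D]] by (auto simp: partial_def mult.commute)
  finally show ?thesis by (simp add: has_field_derivative_def)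
qed

text \<open>The mean value theorem, applied once in direction \<open>u\<close> and once in direction \<open>v\<close>, writes the second
difference as a mixed derivative at a nearby point. The second difference is symmetric in \<open>u\<close> and
\<open>v\<close>, which is what makes mixed derivatives commute.\<close>

lemma second_difference_eq_partial:
  fixes f :: "complex \<Rightarrow> real"
  assumes f: "\<And>x. x \<in> ball w d \<Longrightarrow> f differentiable (at x)"
    and fu: "\<And>x. x \<in> ball w d \<Longrightarrow> partial u f differentiable (at x)"
    and t: "t > 0" "t * (cmod u + cmod v) < d"
  obtains \<xi> where "\<xi> \<in> ball w d"
    "f (w + t *\<^sub>R u + t *\<^sub>R v) - f (w + t *\<^sub>R u) - f (w + t *\<^sub>R v) + f w =
      t\<^sup>2 * partial v (partial u f) \<xi>"
proof -
  have in_ball: "w + s *\<^sub>R u + s' *\<^sub>R v \<in> ball w d" if "0 \<le> s" "s \<le> t" "0 \<le> s'" "s' \<le> t" for s s'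
  proof -
    have "cmod (s *\<^sub>R u + s' *\<^sub>R v) \<le> s * cmod u + s' * cmod v"
      using that norm_triangle_ineq[of "s *\<^sub>R u" "s' *\<^sub>R v"] by simp
    also have "\<dots> \<le> t * cmod u + t * cmod v"
      using that by (intro add_mono mult_right_mono) auto
    also have "\<dots> < d" using t by (simp add: algebra_simps)
    finally show ?thesis
      unfolding mem_ball by (subst dist_commute) (simp add: dist_norm add.assoc)
  qed
  define g where "g s = f ((w + t *\<^sub>R v) + s *\<^sub>R u) - f (w + s *\<^sub>R u)" for s
  have "(g has_real_derivative
      partial u f ((w + t *\<^sub>R v) + s *\<^sub>R u) - partial u f (w + s *\<^sub>R u)) (at s)" if "0 \<le> s" "s \<le> t" for s
  proof -
    have "w + s *\<^sub>R u + t *\<^sub>R v \<in> ball w d" "w + s *\<^sub>R u + 0 *\<^sub>R v \<in> ball w d"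
      using that t by (intro in_ball; simp)+
    moreover have "w + s *\<^sub>R u + t *\<^sub>R v = (w + t *\<^sub>R v) + s *\<^sub>R u"
      "w + s *\<^sub>R u + 0 *\<^sub>R v = w + s *\<^sub>R u" by simp_all
    ultimately have "(w + t *\<^sub>R v) + s *\<^sub>R u \<in> ball w d" "w + s *\<^sub>R u \<in> ball w d" by (simp_all only:)
    thus ?thesis unfolding g_def by (intro DERIV_diff has_real_derivative_along_line f)
  qed
  from MVT2[OF t(1) this] obtain s where s: "0 < s" "s < t"
    "g t - g 0 = (t - 0) * (partial u f ((w + t *\<^sub>R v) + s *\<^sub>R u) - partial u f (w + s *\<^sub>R u))"
    by blast
  have "((\<lambda>s'. partial u f ((w + s *\<^sub>R u) + s' *\<^sub>R v)) has_real_derivative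
      partial v (partial u f) ((w + s *\<^sub>R u) + s' *\<^sub>R v)) (at s')" if "0 \<le> s'" "s' \<le> t" for s'
    by (intro has_real_derivative_along_line fu in_ball) (use that s in auto)
  from MVT2[OF t(1) this] obtain s' where s': "0 < s'" "s' < t"
    "partial u f ((w + s *\<^sub>R u) + t *\<^sub>R v) - partial u f ((w + s *\<^sub>R u) + 0 *\<^sub>R v) =
      (t - 0) * partial v (partial u f) ((w + s *\<^sub>R u) + s' *\<^sub>R v)"
    by blast
  have "f (w + t *\<^sub>R u + t *\<^sub>R v) - f (w + t *\<^sub>R u) - f (w + t *\<^sub>R v) + f w = g t - g 0"
    by (simp add: g_def add_ac)
  also have "\<dots> = t * (partial u f ((w + s *\<^sub>R u) + t *\<^sub>R v) - partial u f (w + s *\<^sub>R u))"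
    using s(3) by (simp add: add_ac)
  also have "\<dots> = t\<^sup>2 * partial v (partial u f) (w + s *\<^sub>R u + s' *\<^sub>R v)"
    using s'(3) by (simp add: power2_eq_square)
  finally show thesis using that[OF in_ball[of s s']] s s' by simp
qed

lemma partial_commute:
  fixes f :: "complex \<Rightarrow> real"
  assumes S: "open S" "w \<in> S"
    and f: "\<And>x. x \<in> S \<Longrightarrow> f differentiable (at x)"
    and fu: "\<And>x. x \<in> S \<Longrightarrow> partial u f differentiable (at x)"
    and fv: "\<And>x. x \<in> S \<Longrightarrow> partial v f differentiable (at x)"
    and cont: "continuous_on S (partial v (partial u f))" "continuous_on S (partial u (partial v f))"
  shows "partial v (partial u f) w = partial u (partial v f) w"
proof (rule ccontr)
  define A B where "A = partial v (partial u f)" and "B = partial u (partial v f)"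
  assume "partial v (partial u f) w \<noteq> partial u (partial v f) w"
  hence e: "\<bar>A w - B w\<bar> / 2 > 0" (is "?e > 0") by (simp add: A_def B_def)
  have "isCont A w" "isCont B w"
    using cont S by (auto simp: A_def B_def continuous_on_eq_continuous_at)
  hence "\<exists>d>0. \<forall>x. dist x w < d \<longrightarrow> dist (A x) (A w) < ?e"
    "\<exists>d>0. \<forall>x. dist x w < d \<longrightarrow> dist (B x) (B w) < ?e"
    using e unfolding continuous_at_eps_delta by blast+
  then obtain d1 d2 where d12: "d1 > 0" "d2 > 0" "\<And>x. dist x w < d1 \<Longrightarrow> dist (A x) (A w) < ?e"
    "\<And>x. dist x w < d2 \<Longrightarrow> dist (B x) (B w) < ?e"
    by blast
  obtain d3 where d3: "d3 > 0" "ball w d3 \<subseteq> S" using S openE by blast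
  define d where "d = min d3 (min d1 d2)"
  have d: "d > 0" "ball w d \<subseteq> S" using d12 d3 by (auto simp: d_def)
  \<comment> \<open>So small that the parallelogram spanned by \<open>t u\<close> and \<open>t v\<close> at \<open>w\<close> stays in \<open>ball w d\<close>.\<close>
  define t where "t = d / (2 * (cmod u + cmod v + 1))"
  have pos: "cmod u + cmod v + 1 > 0" by (simp add: add_nonneg_pos)
  have t: "t > 0" "t * (cmod u + cmod v) < d"
  proof -
    show "t > 0" using d pos by (simp add: t_def)
    hence "t * (cmod u + cmod v) < t * (2 * (cmod u + cmod v + 1))"
      using pos by (intro mult_strict_left_mono) auto
    also have "\<dots> = d" using pos by (simp add: t_def)
    finally show "t * (cmod u + cmod v) < d" .
  qed
  have t': "t * (cmod v + cmod u) < d" using t by (simp add: add.commute)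
  obtain \<xi> where \<xi>: "\<xi> \<in> ball w d"
    "f (w + t *\<^sub>R u + t *\<^sub>R v) - f (w + t *\<^sub>R u) - f (w + t *\<^sub>R v) + f w = t\<^sup>2 * A \<xi>"
    unfolding A_def using second_difference_eq_partial[of w d f u t v] f fu d t by blast
  obtain \<eta> where \<eta>: "\<eta> \<in> ball w d"
    "f (w + t *\<^sub>R v + t *\<^sub>R u) - f (w + t *\<^sub>R v) - f (w + t *\<^sub>R u) + f w = t\<^sup>2 * B \<eta>"
    unfolding B_def using second_difference_eq_partial[of w d f v t u] f fv d t t' by blast
  have swap: "w + t *\<^sub>R v + t *\<^sub>R u = w + t *\<^sub>R u + t *\<^sub>R v" by simp
  have "t\<^sup>2 * A \<xi> = t\<^sup>2 * B \<eta>" using \<xi>(2) \<eta>(2)[unfolded swap] by linarith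
  hence "A \<xi> = B \<eta>" using t by simp
  moreover have "dist (A \<xi>) (A w) < ?e" "dist (B \<eta>) (B w) < ?e"
    using d12(3)[of \<xi>] d12(4)[of \<eta>] \<xi>(1) \<eta>(1) by (simp_all add: d_def dist_commute)
  moreover have "dist (A w) (B w) \<le> dist (A \<xi>) (A w) + dist (A \<xi>) (B w)"
    by (rule dist_triangle3)
  ultimately have "dist (A w) (B w) < ?e + ?e" by simp
  thus False by (simp add: dist_real_def)
qed

lemma open_punctured_disk: "open punctured_disk"
proof -
  have "punctured_disk = ball 0 1 - {0}" by (auto simp: punctured_disk_def)
  moreover have "open (ball 0 1 - {0 :: complex})" by (intro open_Diff) auto
  ultimately show ?thesis by simp
qed

text \<open>For harmonic \<open>f\<close> the function \<open>f\<^sub>x - i f\<^sub>y\<close> satisfies the Cauchy-Riemann equations: one of them is the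
vanishing of the Laplacian and the other is the symmetry of the mixed derivatives. Locally it is
the derivative of a holomorphic function with real part \<open>f\<close>.\<close>

lemma harmonic_imp_holomorphic_gradient:
  assumes S: "open S" and f: "Ck 2 f S" and lap: "\<And>w. w \<in> S \<Longrightarrow> laplacian f w = 0"
  shows "(\<lambda>w. of_real (partial 1 f w) - \<i> * of_real (partial \<i> f w)) holomorphic_on S"
proof -
  have d: "f differentiable (at w)" "partial v f differentiable (at w)"
    "continuous_on S (partial v' (partial v f))" if "w \<in> S" for v v' w
    using f that by (auto simp: numeral_2_eq_2 partial_def[abs_def])
  have "((\<lambda>w. of_real (partial 1 f w) - \<i> * of_real (partial \<i> f w)) has_field_derivative
      (of_real (partial 1 (partial 1 f) w) - \<i> * of_real (partial \<i> (partial 1 f) w))) (at w)"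
    if w: "w \<in> S" for w
  proof -
    have mixed: "partial 1 (partial \<i> f) w = partial \<i> (partial 1 f) w"
      by (rule partial_commute[OF S w]) (use d in \<open>auto intro: d(3)[OF w]\<close>)
    have lap': "partial \<i> (partial \<i> f) w = - partial 1 (partial 1 f) w"
      using lap[OF w] by (simp add: laplacian_def)
    have D: "((\<lambda>w. of_real (partial 1 f w) - \<i> * of_real (partial \<i> f w)) has_derivative
        (\<lambda>h. of_real (Re h * partial 1 (partial 1 f) w + Im h * partial \<i> (partial 1 f) w) -
          \<i> * of_real (Re h * partial 1 (partial \<i> f) w + Im h * partial \<i> (partial \<i> f) w))) (at w)"
      by (intro derivative_intros has_derivative_frechet_complex d(2)[OF w])
    show ?thesis
      unfolding has_field_derivative_def
      by (rule has_derivative_eq_rhs[OF D])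
         (auto simp: fun_eq_iff complex_eq_iff mixed lap' algebra_simps)
  qed
  thus ?thesis using S by (auto simp: holomorphic_on_open)
qed

text \<open>The lift of \<open>\<phi>\<close> along \<open>exp\<close> to the left half plane \<open>H\<close> is the real part of a holomorphic \<open>\<Phi>\<close>, up to a
constant. Since the lift is periodic, \<open>\<Phi>\<close> changes by an imaginary constant \<open>2 \<pi> i \<kappa>\<close> under
translation by \<open>2 \<pi> i\<close>. So \<open>exp (\<Phi>(\<zeta>) - \<kappa> \<zeta>)\<close> is periodic and descends to the punctured disk.\<close>

lemma flat_metric_modulus:
  assumes metric: "conformal_metric \<phi>"
    and flat: "\<forall>w\<in>punctured_disk. gauss_curvature \<phi> w = 0"
  obtains \<kappa> U where "U holomorphic_on punctured_disk"
    "\<And>w. w \<in> punctured_disk \<Longrightarrow> exp (\<phi> w) = cmod w powr \<kappa> * cmod (U w)"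
proof -
  have C2: "Ck 2 \<phi> punctured_disk" using metric by (simp add: conformal_metric_def smooth_def)
  have d: "\<phi> differentiable (at w)" if "w \<in> punctured_disk" for w
    using C2 that by (auto simp: numeral_2_eq_2)
  define G where "G = (\<lambda>w. of_real (partial 1 \<phi> w) - \<i> * of_real (partial \<i> \<phi> w))"
  have G: "G holomorphic_on punctured_disk"
    unfolding G_def
    by (rule harmonic_imp_holomorphic_gradient[OF open_punctured_disk C2])
       (use flat in \<open>simp add: gauss_curvature_def\<close>)
  define H where "H = {\<zeta>. Re \<zeta> < 0}"
  have H: "convex H" "open H" by (auto simp: H_def convex_halfspace_Re_lt open_halfspace_Re_lt)
  have expH: "exp \<zeta> \<in> punctured_disk" if "\<zeta> \<in> H" for \<zeta>
    using that by (simp add: H_def punctured_disk_def)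
  have "(\<lambda>\<zeta>. G (exp \<zeta>) * exp \<zeta>) holomorphic_on H"
    by (intro holomorphic_intros holomorphic_on_compose_gen[OF _ G, unfolded o_def])
       (use expH in auto)
  then obtain \<Phi> where \<Phi>: "\<And>\<zeta>. \<zeta> \<in> H \<Longrightarrow> (\<Phi> has_field_derivative G (exp \<zeta>) * exp \<zeta>) (at \<zeta> within H)"
    using holomorphic_convex_primitive'[OF H] by blast
  hence \<Phi>': "(\<Phi> has_field_derivative G (exp \<zeta>) * exp \<zeta>) (at \<zeta>)" if "\<zeta> \<in> H" for \<zeta>
    using that H(2) at_within_open by metis
  have "((\<lambda>\<zeta>. Re (\<Phi> \<zeta>) - \<phi> (exp \<zeta>)) has_derivative (\<lambda>_. 0)) (at \<zeta> within H)" if \<zeta>: "\<zeta> \<in> H" for \<zeta>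
  proof -
    have "(exp has_derivative (*) (exp \<zeta>)) (at \<zeta>)"
      using DERIV_exp[of \<zeta>] by (simp add: has_field_derivative_def)
    from has_derivative_compose[OF this has_derivative_frechet_complex[OF d[OF expH[OF \<zeta>]]]]
    have 1: "((\<lambda>\<zeta>. \<phi> (exp \<zeta>)) has_derivative
      (\<lambda>h. Re (exp \<zeta> * h) * partial 1 \<phi> (exp \<zeta>) + Im (exp \<zeta> * h) * partial \<i> \<phi> (exp \<zeta>))) (at \<zeta>)" .
    have 2: "((\<lambda>\<zeta>. Re (\<Phi> \<zeta>)) has_derivative (\<lambda>h. Re (G (exp \<zeta>) * exp \<zeta> * h))) (at \<zeta>)"
      using \<Phi>'[OF \<zeta>] unfolding has_field_derivative_def by (intro derivative_intros)
    have "((\<lambda>\<zeta>. Re (\<Phi> \<zeta>) - \<phi> (exp \<zeta>)) has_derivative (\<lambda>_. 0)) (at \<zeta>)"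
      by (rule has_derivative_eq_rhs[OF has_derivative_diff[OF 2 1]])
         (auto simp: fun_eq_iff G_def algebra_simps)
    thus ?thesis by (rule has_derivative_at_withinI)
  qed
  from has_derivative_zero_constant[OF H(1) this]
  obtain c where c: "\<And>\<zeta>. \<zeta> \<in> H \<Longrightarrow> Re (\<Phi> \<zeta>) - \<phi> (exp \<zeta>) = c" by blast
  have per_exp: "exp (\<zeta> + 2 * of_real pi * \<i>) = exp \<zeta>" for \<zeta> :: complex
    by (simp add: exp_add)
  have perH: "\<zeta> + 2 * of_real pi * \<i> \<in> H \<longleftrightarrow> \<zeta> \<in> H" for \<zeta> by (simp add: H_def)
  have "((\<lambda>\<zeta>. \<Phi> (\<zeta> + 2 * of_real pi * \<i>) - \<Phi> \<zeta>) has_field_derivative 0) (at \<zeta> within H)"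
    if \<zeta>: "\<zeta> \<in> H" for \<zeta>
  proof -
    have "((\<lambda>\<zeta>. \<Phi> (\<zeta> + 2 * of_real pi * \<i>)) has_field_derivative G (exp \<zeta>) * exp \<zeta>) (at \<zeta>)"
      using \<Phi>'[of "\<zeta> + 2 * of_real pi * \<i>"] \<zeta> perH per_exp
      by (simp add: DERIV_shift)
    from DERIV_diff[OF this \<Phi>'[OF \<zeta>]] show ?thesis
      by (simp add: has_field_derivative_at_within)
  qed
  from has_field_derivative_zero_constant[OF H(1) this]
  obtain P where P: "\<And>\<zeta>. \<zeta> \<in> H \<Longrightarrow> \<Phi> (\<zeta> + 2 * of_real pi * \<i>) - \<Phi> \<zeta> = P" by blast
  have m1: "-1 \<in> H" by (simp add: H_def)
  hence m2: "-1 + 2 * of_real pi * \<i> \<in> H" using perH by blast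
  have "Re P = Re (\<Phi> (-1 + 2 * of_real pi * \<i>)) - Re (\<Phi> (-1))"
    using P[OF m1] by (metis minus_complex.simps(1))
  also have "\<dots> = 0"
    using c[OF m1] c[OF m2] unfolding per_exp by linarith
  finally have ReP: "Re P = 0" .
  define \<kappa> where "\<kappa> = Im P / (2 * pi)"
  have P_eq: "P = of_real \<kappa> * (2 * of_real pi * \<i>)"
    using ReP by (simp add: complex_eq_iff \<kappa>_def)
  define E where "E \<zeta> = exp (\<Phi> \<zeta> - of_real c - of_real \<kappa> * \<zeta>)" for \<zeta>
  have E_per: "E (\<zeta> + 2 * of_real pi * \<i>) = E \<zeta>" if "\<zeta> \<in> H" for \<zeta>
  proof -
    have "\<Phi> (\<zeta> + 2 * of_real pi * \<i>) = \<Phi> \<zeta> + of_real \<kappa> * (2 * of_real pi * \<i>)"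
      using P[OF that] P_eq by (simp add: algebra_simps)
    thus ?thesis by (simp add: E_def algebra_simps)
  qed
  have E_hol: "E holomorphic_on H"
    unfolding E_def using \<Phi>' H(2) by (intro holomorphic_intros) (auto simp: holomorphic_on_open)
  \<comment> \<open>The principal logarithm jumps on the negative axis; there the branch \<open>Ln (- w) + \<pi> i\<close> shows that
    \<open>U\<close> is holomorphic, as both branches give the same value by periodicity of \<open>E\<close>.\<close>
  define U where "U w = E (Ln w)" for w
  have LnH: "Ln w \<in> H" if "w \<in> punctured_disk" for w
    using that by (auto simp: H_def punctured_disk_def Re_Ln)
  have "exp (\<phi> w) = cmod w powr \<kappa> * cmod (U w)" if w: "w \<in> punctured_disk" for w
  proof -
    have w0: "w \<noteq> 0" using w by (auto simp: punctured_disk_def)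
    have "cmod (U w) = exp (\<phi> w - \<kappa> * ln (cmod w))"
      using c[OF LnH[OF w]] w0 by (simp add: U_def E_def Re_Ln)
    thus ?thesis using w0 by (simp add: powr_def exp_add[symmetric])
  qed
  moreover have "U holomorphic_on punctured_disk"
  proof -
    have 1: "U holomorphic_on (punctured_disk - \<real>\<^sub>\<le>\<^sub>0)"
      unfolding U_def
      by (rule holomorphic_on_compose_gen[OF _ E_hol, unfolded o_def])
         (use LnH in \<open>auto intro!: holomorphic_intros\<close>)
    have "(\<lambda>w. E (Ln (- w) + of_real pi * \<i>)) holomorphic_on (punctured_disk - \<real>\<^sub>\<ge>\<^sub>0)"
      by (rule holomorphic_on_compose_gen[OF _ E_hol, unfolded o_def])
         (auto intro!: holomorphic_intros simp: H_def punctured_disk_def Re_Ln)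
    moreover have "E (Ln (- w) + of_real pi * \<i>) = U w" if w: "w \<in> punctured_disk - \<real>\<^sub>\<ge>\<^sub>0" for w
    proof -
      have w0: "- w \<noteq> 0" and w': "w \<in> punctured_disk" using w by (auto simp: punctured_disk_def)
      from Ln_minus[OF w0] consider "Ln w = Ln (- w) + \<i> * of_real pi" | "Ln w = Ln (- w) - \<i> * of_real pi"
        by (auto split: if_splits)
      thus ?thesis
      proof cases
        case 1
        thus ?thesis by (simp add: U_def mult.commute)
      next
        case 2
        hence eq: "Ln (- w) + of_real pi * \<i> = Ln w + 2 * of_real pi * \<i>"
          by (simp add: algebra_simps)
        show ?thesis unfolding eq U_def by (rule E_per[OF LnH[OF w']])
      qed
    qed
    ultimately have 2: "U holomorphic_on (punctured_disk - \<real>\<^sub>\<ge>\<^sub>0)"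
      using holomorphic_transform by blast
    have "U field_differentiable (at w)" if w: "w \<in> punctured_disk" for w
    proof (cases "w \<in> \<real>\<^sub>\<le>\<^sub>0")
      case False
      have "open (punctured_disk - \<real>\<^sub>\<le>\<^sub>0)" by (intro open_Diff open_punctured_disk) auto
      thus ?thesis using holomorphic_on_imp_differentiable_at[OF 1] w False by blast
    next
      case True
      have "open (punctured_disk - \<real>\<^sub>\<ge>\<^sub>0)" by (intro open_Diff open_punctured_disk) auto
      moreover have "w \<notin> \<real>\<^sub>\<ge>\<^sub>0"
        using True w by (auto simp: complex_nonpos_Reals_iff complex_nonneg_Reals_iff punctured_disk_def complex_eq_iff)
      ultimately show ?thesis using holomorphic_on_imp_differentiable_at[OF 2] w by blast
    qed
    thus ?thesis by (auto simp: holomorphic_on_def field_differentiable_at_within)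
  qed
  ultimately show thesis using that by blast
qed

section \<open>The area mean value inequality\<close>

lemma nn_integral_lborel_complex:
  fixes f :: "complex \<Rightarrow> ennreal"
  assumes [measurable]: "f \<in> borel_measurable borel"
  shows "(\<integral>\<^sup>+z. f z \<partial>lborel) = (\<integral>\<^sup>+x. \<integral>\<^sup>+y. f (Complex x y) \<partial>lborel \<partial>lborel)"
proof -
  have meas: "(\<lambda>p :: real \<times> real. Complex (fst p) (snd p)) \<in> borel \<rightarrow>\<^sub>M borel"
    by (intro borel_measurable_continuous_onI) (auto simp: Complex_eq intro!: continuous_intros)
  hence meas'[measurable]: "(\<lambda>p :: real \<times> real. Complex (fst p) (snd p)) \<in> lborel \<Otimes>\<^sub>M lborel \<rightarrow>\<^sub>M borel"
    by (simp add: lborel_prod)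
  have eq: "(lborel :: complex measure) =
      distr (lborel \<Otimes>\<^sub>M lborel) borel (\<lambda>p. Complex (fst p) (snd p))"
  proof (rule lborel_eqI)
    fix l u :: complex
    assume le: "\<And>b. b \<in> Basis \<Longrightarrow> l \<bullet> b \<le> u \<bullet> b"
    have le': "Re l \<le> Re u" "Im l \<le> Im u"
      using le[of 1] le[of \<i>] by (auto simp: Basis_complex_def)
    have "(\<lambda>p. Complex (fst p) (snd p)) -` box l u \<inter> space (lborel \<Otimes>\<^sub>M lborel) =
      {Re l<..<Re u} \<times> {Im l<..<Im u}"
      by (auto simp: box_def Basis_complex_def space_pair_measure)
    thus "emeasure (distr (lborel \<Otimes>\<^sub>M lborel) borel (\<lambda>p. Complex (fst p) (snd p))) (box l u) =
        ennreal (\<Prod>b\<in>Basis. (u - l) \<bullet> b)"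
      using le' by (simp add: emeasure_distr lborel.emeasure_pair_measure_Times Basis_complex_def
            ennreal_mult inner_diff_left)
  qed simp
  show ?thesis
    by (subst eq, subst nn_integral_distr)
       (auto simp: lborel.nn_integral_fst[symmetric] split_def)
qed

text \<open>If \<open>c = p + i q\<close> with \<open>p \<noteq> 0\<close>, then rotation by \<open>c\<close> is the composition of two maps, each of which is
affine in one real coordinate while the other is fixed. Their Jacobians \<open>p\<close> and \<open>1 / p\<close> cancel.\<close>

lemma nn_integral_lborel_rotate_Re_nonzero:
  fixes f :: "complex \<Rightarrow> ennreal" and c :: complex
  assumes [measurable]: "f \<in> borel_measurable borel" and c: "cmod c = 1" "Re c \<noteq> 0"
  shows "(\<integral>\<^sup>+z. f (c * z) \<partial>lborel) = (\<integral>\<^sup>+z. f z \<partial>lborel)"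
proof -
  define p q where "p = Re c" and "q = Im c"
  have pq: "p\<^sup>2 + q\<^sup>2 = 1" "p \<noteq> 0"
    using c cmod_power2[of c] by (auto simp: p_def q_def)
  define F where "F = (\<lambda>x y. f (Complex x y))"
  have meas: "(\<lambda>p :: real \<times> real. Complex (fst p) (snd p)) \<in> borel \<rightarrow>\<^sub>M borel"
    by (intro borel_measurable_continuous_onI) (auto simp: Complex_eq intro!: continuous_intros)
  hence "(\<lambda>p :: real \<times> real. Complex (fst p) (snd p)) \<in> borel \<Otimes>\<^sub>M borel \<rightarrow>\<^sub>M borel"
    by (simp add: borel_prod)
  from measurable_compose[OF this assms(1)]
  have mF: "(\<lambda>p. F (fst p) (snd p)) \<in> borel_measurable (borel \<Otimes>\<^sub>M borel)"
    unfolding F_def by simp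
  have mF' [measurable (raw)]: "(\<lambda>x. F (g x) (h x)) \<in> borel_measurable M"
    if "g \<in> borel_measurable M" "h \<in> borel_measurable M" for g h and M :: "'c measure"
    using measurable_compose[OF measurable_Pair[OF that] mF] by simp
  have swap: "(\<integral>\<^sup>+x. \<integral>\<^sup>+y. G x y \<partial>lborel \<partial>lborel) = (\<integral>\<^sup>+y. \<integral>\<^sup>+x. G x y \<partial>lborel \<partial>lborel)"
    if "case_prod G \<in> borel_measurable (lborel \<Otimes>\<^sub>M lborel)" for G :: "real \<Rightarrow> real \<Rightarrow> ennreal"
    using lborel_pair.Fubini[OF that] by simp
  have cancel: "ennreal \<bar>p\<bar> * (ennreal \<bar>1 / p\<bar> * X) = X" for X
    using pq(2) by (simp add: mult.assoc[symmetric] ennreal_mult[symmetric] abs_mult[symmetric])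
  have "(\<integral>\<^sup>+z. f (c * z) \<partial>lborel) = (\<integral>\<^sup>+x. \<integral>\<^sup>+y. F (p * x - q * y) (q * x + p * y) \<partial>lborel \<partial>lborel)"
    by (subst nn_integral_lborel_complex)
       (auto intro!: nn_integral_cong arg_cong[of _ _ f] simp: F_def complex_eq_iff p_def q_def)
  also have "\<dots> = (\<integral>\<^sup>+y. \<integral>\<^sup>+x. F (p * x - q * y) (q * x + p * y) \<partial>lborel \<partial>lborel)"
    by (rule swap) simp
  also have "\<dots> = (\<integral>\<^sup>+y. ennreal \<bar>1/p\<bar> * (\<integral>\<^sup>+t. F t ((q * t + y) / p) \<partial>lborel) \<partial>lborel)"
  proof (rule nn_integral_cong)
    fix y :: real
    have "q * (q * y / p + 1 / p * t) + p * y = (q * t + y) / p" for t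
    proof -
      have "q * (q * y / p + 1 / p * t) + p * y = ((p\<^sup>2 + q\<^sup>2) * y + q * t) / p"
        using pq(2) by (simp add: field_simps power2_eq_square)
      thus ?thesis using pq(1) by (simp add: algebra_simps)
    qed
    moreover have "p * (q * y / p + 1 / p * t) - q * y = t" for t
      using pq(2) by (simp add: field_simps)
    ultimately show "(\<integral>\<^sup>+x. F (p * x - q * y) (q * x + p * y) \<partial>lborel) =
        ennreal \<bar>1/p\<bar> * (\<integral>\<^sup>+t. F t ((q * t + y) / p) \<partial>lborel)"
      using pq(2) by (subst nn_integral_real_affine[where c = "1/p" and t = "q * y / p"]) auto
  qed
  also have "\<dots> = ennreal \<bar>1/p\<bar> * (\<integral>\<^sup>+y. \<integral>\<^sup>+t. F t ((q * t + y) / p) \<partial>lborel \<partial>lborel)"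
    by (rule nn_integral_cmult) simp
  also have "(\<integral>\<^sup>+y. \<integral>\<^sup>+t. F t ((q * t + y) / p) \<partial>lborel \<partial>lborel) =
      (\<integral>\<^sup>+t. \<integral>\<^sup>+y. F t ((q * t + y) / p) \<partial>lborel \<partial>lborel)"
    by (rule swap[symmetric]) simp
  also have "\<dots> = (\<integral>\<^sup>+t. ennreal \<bar>p\<bar> * (\<integral>\<^sup>+v. F t v \<partial>lborel) \<partial>lborel)"
  proof (rule nn_integral_cong)
    fix t :: real
    show "(\<integral>\<^sup>+y. F t ((q * t + y) / p) \<partial>lborel) = ennreal \<bar>p\<bar> * (\<integral>\<^sup>+v. F t v \<partial>lborel)"
      using pq(2) by (subst nn_integral_real_affine[where c = p and t = "- q * t"]) auto
  qed
  also have "\<dots> = ennreal \<bar>p\<bar> * (\<integral>\<^sup>+t. \<integral>\<^sup>+v. F t v \<partial>lborel \<partial>lborel)"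
    by (rule nn_integral_cmult) simp
  also have "ennreal \<bar>1/p\<bar> * (ennreal \<bar>p\<bar> * (\<integral>\<^sup>+t. \<integral>\<^sup>+v. F t v \<partial>lborel \<partial>lborel)) =
      (\<integral>\<^sup>+t. \<integral>\<^sup>+v. F t v \<partial>lborel \<partial>lborel)"
    using cancel by (simp add: mult.left_commute)
  also have "\<dots> = (\<integral>\<^sup>+z. f z \<partial>lborel)"
    by (simp add: nn_integral_lborel_complex F_def)
  finally show ?thesis .
qed

text \<open>The remaining rotations, by \<open>c = \<plusminus>i\<close>, are squares of rotations covered by the previous lemma.\<close>

lemma nn_integral_lborel_rotate:
  fixes f :: "complex \<Rightarrow> ennreal" and c :: complex
  assumes [measurable]: "f \<in> borel_measurable borel" and c: "cmod c = 1"
  shows "(\<integral>\<^sup>+z. f (c * z) \<partial>lborel) = (\<integral>\<^sup>+z. f z \<partial>lborel)"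
proof (cases "Re c = 0")
  case False
  thus ?thesis using nn_integral_lborel_rotate_Re_nonzero assms by blast
next
  case True
  define d where "d = csqrt c"
  have d: "d * d = c" by (simp add: d_def power2_eq_square[symmetric])
  have "cmod d = 1" using c by (simp add: d_def norm_csqrt)
  moreover have "Re d \<noteq> 0"
    using c True by (simp add: d_def)
  ultimately have *: "(\<integral>\<^sup>+z. g (d * z) \<partial>lborel) = (\<integral>\<^sup>+z. g z \<partial>lborel)"
    if "g \<in> borel_measurable borel" for g :: "complex \<Rightarrow> ennreal"
    using nn_integral_lborel_rotate_Re_nonzero that by blast
  have "(\<integral>\<^sup>+z. f (c * z) \<partial>lborel) = (\<integral>\<^sup>+z. f (d * (d * z)) \<partial>lborel)"
    by (simp add: d[symmetric] mult.assoc)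
  also have "\<dots> = (\<integral>\<^sup>+z. f (d * z) \<partial>lborel)"
    by (rule *) measurable
  also have "\<dots> = (\<integral>\<^sup>+z. f z \<partial>lborel)"
    by (rule *) measurable
  finally show ?thesis .
qed

text \<open>Cauchy's formula for \<open>u \<mapsto> f (w + u z)\<close> on the unit circle. The circle is parametrised as the orbit of
the point \<open>z\<close> under rotation, to be averaged over \<open>z\<close> below.\<close>

lemma cmod_le_circle_mean:
  assumes f: "f holomorphic_on ball w s" and z: "cmod z < s"
  shows "ennreal (cmod (f w)) \<le>
    (\<integral>\<^sup>+x\<in>{0..1}. ennreal (cmod (f (w + exp (2 * of_real pi * \<i> * of_real x) * z))) \<partial>lborel)"
proof -
  define g where "g = (\<lambda>u. f (w + u * z))"
  define e where "e = (\<lambda>x::real. exp (2 * of_real pi * \<i> * of_real x) :: complex)"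
  have in_ball: "w + u * z \<in> ball w s" if "cmod u \<le> 1" for u
  proof -
    have "cmod (u * z) \<le> cmod z"
      unfolding norm_mult using that by (simp add: mult_left_le_one_le)
    thus ?thesis using z by (simp add: dist_norm)
  qed
  have g: "g holomorphic_on cball 0 1"
    unfolding g_def
    by (rule holomorphic_on_compose_gen[of _ _ f "ball w s", unfolded o_def])
       (auto intro!: holomorphic_intros f simp: in_ball simp del: mem_ball)
  have "((\<lambda>u. g u / (u - 0)) has_contour_integral (2 * of_real pi * \<i> * g 0)) (circlepath 0 1)"
    by (rule Cauchy_integral_circlepath_simple[OF g]) auto
  hence "((\<lambda>x. g (e x) / e x * (2 * of_real pi * \<i> * e x)) has_integral (2 * of_real pi * \<i> * g 0)) {0..1}"
    unfolding has_contour_integral vector_derivative_circlepath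
    by (simp add: circlepath e_def mult_ac)
  hence "((\<lambda>x. (2 * of_real pi * \<i>) * g (e x)) has_integral (2 * of_real pi * \<i> * g 0)) {0..1}"
    by (simp add: e_def mult_ac)
  from has_integral_mult_right[OF this, of "1 / (2 * of_real pi * \<i>)"]
  have int: "((\<lambda>x. g (e x)) has_integral g 0) {0..1}"
    by simp
  have "continuous_on {0..1} (\<lambda>x. g (e x))"
    by (rule continuous_on_compose2[OF holomorphic_on_imp_continuous_on[OF g]])
       (auto simp: e_def intro!: continuous_intros)
  hence si: "set_integrable lborel {0..1} (\<lambda>x. g (e x))"
    by (rule borel_integrable_atLeastAtMost')
  have "g 0 = (LINT x:{0..1}|lborel. g (e x))"
    using set_borel_integral_eq_integral(2)[OF si] int by (simp add: integral_unique)
  also have "ennreal (cmod \<dots>) \<le> (\<integral>\<^sup>+x. ennreal (norm (indicator {0..1} x *\<^sub>R g (e x))) \<partial>lborel)"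
    unfolding set_lebesgue_integral_def
    by (rule integral_norm_bound_ennreal) (use si in \<open>simp add: set_integrable_def\<close>)
  also have "\<dots> = (\<integral>\<^sup>+x\<in>{0..1}. ennreal (cmod (g (e x))) \<partial>lborel)"
    by (intro nn_integral_cong) (auto simp: indicator_def)
  finally show ?thesis by (simp add: g_def e_def)
qed

text \<open>Integrating the circle mean over the starting point \<open>z\<close> in the disk and exchanging the integrals,
rotation invariance makes the inner integral independent of the angle. This gives the mean over
the disk without polar coordinates.\<close>

lemma cmod_le_area_mean:
  assumes f: "f holomorphic_on ball w s" and s: "s > 0"
  shows "ennreal (pi * s\<^sup>2 * cmod (f w)) \<le> (\<integral>\<^sup>+z\<in>ball w s. ennreal (cmod (f z)) \<partial>lborel)"
proof -
  define e where "e = (\<lambda>x::real. exp (2 * of_real pi * \<i> * of_real x) :: complex)"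
  have cmod_e[simp]: "cmod (e x) = 1" for x by (simp add: e_def)
  define h where "h = (\<lambda>z. indicator (ball w s) z * ennreal (cmod (f z)))"
  have "(\<lambda>z. indicator (ball w s) z *\<^sub>R f z) \<in> borel_measurable borel"
    by (rule borel_measurable_continuous_on_indicator)
       (auto intro!: holomorphic_on_imp_continuous_on f)
  hence "(\<lambda>z. ennreal (cmod (indicator (ball w s) z *\<^sub>R f z))) \<in> borel_measurable borel"
    by measurable
  also have "(\<lambda>z. ennreal (cmod (indicator (ball w s) z *\<^sub>R f z))) = h"
    by (auto simp: h_def indicator_def)
  finally have mh[measurable]: "h \<in> borel_measurable borel" .
  have [measurable]: "e \<in> borel_measurable borel"
    unfolding e_def by (intro borel_measurable_continuous_onI continuous_intros)
  have vol: "emeasure lborel (ball 0 s :: complex set) = ennreal (pi * s\<^sup>2)"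
    using s by (subst emeasure_ball) (auto simp: DIM_complex unit_ball_vol_2)
  have "ennreal (pi * s\<^sup>2 * cmod (f w)) =
      (\<integral>\<^sup>+z. ennreal (cmod (f w)) * indicator (ball 0 s) z \<partial>(lborel :: complex measure))"
    using vol s by (simp add: nn_integral_cmult_indicator ennreal_mult mult.commute)
  also have "\<dots> \<le> (\<integral>\<^sup>+z. \<integral>\<^sup>+x. indicator {0..1} x * h (w + e x * z) \<partial>(lborel :: real measure) \<partial>(lborel :: complex measure))"
  proof (rule nn_integral_mono)
    fix z :: complex
    show "ennreal (cmod (f w)) * indicator (ball 0 s) z \<le> (\<integral>\<^sup>+x. indicator {0..1} x * h (w + e x * z) \<partial>(lborel :: real measure))"
    proof (cases "z \<in> ball 0 s")
      case True
      hence z: "cmod z < s" by simp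
      have "w + e x * z \<in> ball w s" for x using z by (simp add: dist_norm norm_mult)
      thus ?thesis using cmod_le_circle_mean[OF f z] True
        by (simp add: h_def e_def mult.commute)
    qed auto
  qed
  also have "\<dots> = (\<integral>\<^sup>+x. \<integral>\<^sup>+z. indicator {0..1} x * h (w + e x * z) \<partial>(lborel :: complex measure) \<partial>(lborel :: real measure))"
    by (rule pair_sigma_finite.Fubini'[symmetric])
       (auto intro!: pair_sigma_finite.intro lborel.sigma_finite_measure_axioms sigma_finite_lborel)
  also have "\<dots> = (\<integral>\<^sup>+x. indicator {0..1} x * (\<integral>\<^sup>+z. h (w + z) \<partial>(lborel :: complex measure)) \<partial>(lborel :: real measure))"
  proof (rule nn_integral_cong)
    fix x :: real
    show "(\<integral>\<^sup>+z. indicator {0..1} x * h (w + e x * z) \<partial>(lborel :: complex measure)) =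
        indicator {0..1} x * (\<integral>\<^sup>+z. h (w + z) \<partial>(lborel :: complex measure))"
      using nn_integral_lborel_rotate[of "\<lambda>z. h (w + z)" "e x"]
      by (subst nn_integral_cmult) auto
  qed
  also have "\<dots> = (\<integral>\<^sup>+z. h (w + z) \<partial>(lborel :: complex measure))"
    by (simp add: nn_integral_multc)
  also have "\<dots> = (\<integral>\<^sup>+z. h z \<partial>(lborel :: complex measure))"
    by (subst lborel_distr_plus[symmetric, of w], subst nn_integral_distr) auto
  also have "\<dots> = (\<integral>\<^sup>+z\<in>ball w s. ennreal (cmod (f z)) \<partial>lborel)"
    by (simp add: h_def mult.commute)
  finally show ?thesis .
qed

section \<open>Polynomial area growth excludes an essential singularity\<close>

text \<open>The metric is the square of the modulus of the (multivalued) holomorphic 1-form \<open>w\<^sup>s u(w) dw\<close>. At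
points other than the origin \<open>u\<close> cannot vanish, since \<open>exp\<close> is positive.\<close>

definition flat_density :: "(complex \<Rightarrow> real) \<Rightarrow> real \<Rightarrow> (complex \<Rightarrow> complex) \<Rightarrow> real \<Rightarrow> bool" where
  "flat_density \<phi> s u \<epsilon> \<longleftrightarrow> 0 < \<epsilon> \<and> u holomorphic_on ball 0 \<epsilon> \<and> u 0 \<noteq> 0 \<and>
     (\<forall>w\<in>ball 0 \<epsilon> - {0}. exp (\<phi> w) = cmod w powr s * cmod (u w))"

text \<open>A disk of radius \<open>|w| / 2\<close> around \<open>w\<close> lies in the annulus of inner radius \<open>|w| / 2\<close>, whose area is at
most \<open>M (2 / |w|)\<^sup>N\<close>. The area mean value inequality for \<open>(w\<^sup>m U)\<^sup>2\<close> then loses a factor \<open>|w|\<^bsup>-N-2\<^esup>\<close>,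
which a large \<open>m\<close> compensates.\<close>

lemma area_growth_imp_bounded:
  assumes U: "U holomorphic_on punctured_disk"
    and mod: "\<And>w. w \<in> punctured_disk \<Longrightarrow> exp (\<phi> w) = cmod w powr \<kappa> * cmod (U w)"
    and cont: "continuous_on punctured_disk \<phi>"
    and R: "0 < R" "R < 1" and M: "M > 0"
    and growth: "\<forall>r>1/R. area \<phi> (annulus (1/r) R) \<le> ennreal (M * r powr N)"
  obtains m :: nat and B where "\<And>w. 0 < cmod w \<Longrightarrow> cmod w < R / 2 \<Longrightarrow> cmod (w ^ m * U w) \<le> B"
proof -
  obtain m :: nat where m: "\<bar>\<kappa>\<bar> + \<bar>N\<bar> + 1 \<le> real m" using real_arch_simple by blast
  \<comment> \<open>The exponent for which \<open>|f| = |w|\<^sup>e e\<^bsup>2 \<phi>\<^esup>\<close>.\<close>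
  define e where "e = 2 * real m - 2 * \<kappa>"
  have e: "e \<ge> 0" "e - N - 2 \<ge> 0" using m by (auto simp: e_def)
  define f where "f w = (w ^ m * U w)\<^sup>2" for w
  define B where "B = 2 powr e * (M * 2 powr N) * 4 / pi"
  have B: "B \<ge> 0" using M by (simp add: B_def)
  have f_hol: "f holomorphic_on punctured_disk" unfolding f_def by (intro holomorphic_intros U)
  have f_eq: "cmod (f z) = cmod z powr e * exp (2 * \<phi> z)" if z: "z \<in> punctured_disk" for z
  proof -
    have z0: "cmod z > 0" using z by (simp add: punctured_disk_def)
    have "exp (2 * \<phi> z) = (cmod z powr \<kappa> * cmod (U z))\<^sup>2"
      by (simp add: exp_double mod[OF z])
    also have "\<dots> = cmod z powr (2 * \<kappa>) * (cmod (U z))\<^sup>2"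
      by (simp add: power_mult_distrib power2_eq_square[of "_ powr _"] powr_add[symmetric])
    finally have "cmod z powr e * exp (2 * \<phi> z) = cmod z powr (real (2 * m)) * (cmod (U z))\<^sup>2"
      by (simp add: e_def powr_add[symmetric] mult.assoc[symmetric])
    also have "cmod z powr (real (2 * m)) = cmod z ^ (2 * m)" by (rule powr_realpow[OF z0])
    also have "\<dots> * (cmod (U z))\<^sup>2 = cmod (f z)"
      by (simp add: f_def norm_mult norm_power power_mult_distrib power_mult[symmetric] mult.commute)
    finally show ?thesis by simp
  qed
  have meas: "(\<lambda>z. ennreal (exp (2 * \<phi> z)) * indicator (annulus a R) z) \<in> borel_measurable lborel"
    if "a > 0" for a
  proof -
    have sub: "annulus a R \<subseteq> punctured_disk" using that R by (auto simp: annulus_def punctured_disk_def)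
    have "annulus a R \<in> sets borel"
      unfolding annulus_def by (intro borel_open open_Collect_conj open_Collect_less continuous_intros)
    hence "(\<lambda>z. indicator (annulus a R) z *\<^sub>R exp (2 * \<phi> z)) \<in> borel_measurable borel"
      by (intro borel_measurable_continuous_on_indicator continuous_intros continuous_on_subset[OF cont sub])
    hence "(\<lambda>z. ennreal (indicator (annulus a R) z *\<^sub>R exp (2 * \<phi> z))) \<in> borel_measurable lborel"
      by simp
    also have "(\<lambda>z. ennreal (indicator (annulus a R) z *\<^sub>R exp (2 * \<phi> z))) =
        (\<lambda>z. ennreal (exp (2 * \<phi> z)) * indicator (annulus a R) z)"
      by (auto simp: indicator_def)
    finally show ?thesis .
  qed
  have "cmod (w ^ m * U w) \<le> sqrt B" if w: "0 < cmod w" "cmod w < R / 2" for w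
  proof -
    define t where "t = cmod w"
    have t: "0 < t" "t < R / 2" "t < 1" using w R by (auto simp: t_def)
    define r where "r = 2 / t"
    have r: "r > 1 / R" "1 / r = t / 2" using t R by (auto simp: r_def field_simps)
    have sub: "z \<in> annulus (1 / r) R" "z \<in> punctured_disk" "cmod z \<le> 2 * t" if z: "z \<in> ball w (t / 2)" for z
    proof -
      have "\<bar>cmod w - cmod z\<bar> < t / 2"
        using z norm_triangle_ineq3[of w z] by (simp add: dist_norm)
      hence "t / 2 < cmod z" "cmod z < 3 * t / 2" by (auto simp: t_def abs_if split: if_splits)
      thus "z \<in> annulus (1 / r) R" "z \<in> punctured_disk" "cmod z \<le> 2 * t"
        unfolding r(2) annulus_def punctured_disk_def using t R by auto
    qed
    have "ennreal (pi * (t / 2)\<^sup>2 * cmod (f w)) \<le> (\<integral>\<^sup>+z\<in>ball w (t / 2). ennreal (cmod (f z)) \<partial>lborel)"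
      by (rule cmod_le_area_mean) (use t sub in \<open>auto intro: holomorphic_on_subset[OF f_hol]\<close>)
    also have "\<dots> \<le> (\<integral>\<^sup>+z. ennreal ((2 * t) powr e) *
        (ennreal (exp (2 * \<phi> z)) * indicator (annulus (1 / r) R) z) \<partial>lborel)"
    proof (rule nn_integral_mono)
      fix z :: complex
      show "ennreal (cmod (f z)) * indicator (ball w (t / 2)) z \<le>
          ennreal ((2 * t) powr e) * (ennreal (exp (2 * \<phi> z)) * indicator (annulus (1 / r) R) z)"
      proof (cases "z \<in> ball w (t / 2)")
        case True
        have "cmod (f z) \<le> (2 * t) powr e * exp (2 * \<phi> z)"
          unfolding f_eq[OF sub(2)[OF True]]
          using sub(3)[OF True] e by (intro mult_right_mono powr_mono2) auto
        thus ?thesis using True sub(1)[OF True] by (simp add: ennreal_mult[symmetric])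
      qed auto
    qed
    also have "\<dots> = ennreal ((2 * t) powr e) * area \<phi> (annulus (1 / r) R)"
      unfolding area_def by (intro nn_integral_cmult meas) (use t R r in auto)
    also have "\<dots> \<le> ennreal ((2 * t) powr e) * ennreal (M * r powr N)"
      using growth r(1) by (intro mult_left_mono) auto
    also have "\<dots> = ennreal ((2 * t) powr e * (M * r powr N))"
      using M by (simp add: ennreal_mult)
    finally have "pi * (t / 2)\<^sup>2 * cmod (f w) \<le> (2 * t) powr e * (M * r powr N)"
      using M by (simp add: ennreal_le_iff)
    also have "\<dots> = 2 powr e * (M * 2 powr N) * t powr (e - N)"
      using t by (simp add: r_def powr_mult powr_divide powr_diff)
    also have "t powr (e - N) = t powr (e - N - 2) * t\<^sup>2"
      using t by (simp add: powr_diff powr_numeral)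
    also have "\<dots> \<le> 1 * t\<^sup>2"
      using t e by (intro mult_right_mono powr_le1) auto
    finally have "pi * (t / 2)\<^sup>2 * cmod (f w) \<le> 2 powr e * (M * 2 powr N) * t\<^sup>2"
      using M by simp
    hence "t\<^sup>2 * cmod (f w) \<le> t\<^sup>2 * B"
      by (simp add: B_def field_simps power2_eq_square)
    hence "(cmod (w ^ m * U w))\<^sup>2 \<le> B"
      using t by (simp add: f_def norm_power)
    thus ?thesis by (rule real_le_rsqrt)
  qed
  thus thesis using that by blast
qed

text \<open>By Riemann's theorem \<open>w\<^sup>m U\<close> extends over the origin; dividing by its power of \<open>w\<close> at the origin leaves
a function without zero there.\<close>

lemma bounded_modulus_imp_flat_density:
  assumes U: "U holomorphic_on punctured_disk"
    and mod: "\<And>w. w \<in> punctured_disk \<Longrightarrow> exp (\<phi> w) = cmod w powr \<kappa> * cmod (U w)"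
    and b: "0 < b" "\<And>w. 0 < cmod w \<Longrightarrow> cmod w < b \<Longrightarrow> cmod (w ^ m * U w) \<le> B"
  shows "\<exists>s u r. flat_density \<phi> s u r"
proof -
  have D: "punctured_disk = ball 0 1 - {0}" by (auto simp: punctured_disk_def)
  have "(\<lambda>w. w ^ m * U w) holomorphic_on ball 0 1 - {0}"
    using U unfolding D by (intro holomorphic_intros)
  moreover have "eventually (\<lambda>w. cmod (w ^ m * U w) \<le> B) (at 0)"
    using b unfolding eventually_at by (intro exI[of _ b]) auto
  ultimately obtain V where V: "V holomorphic_on ball 0 1"
      "\<And>w. w \<in> ball 0 1 - {0} \<Longrightarrow> V w = w ^ m * U w"
    using holomorphic_on_extend_bounded[of "\<lambda>w. w ^ m * U w" "ball 0 1" 0] by auto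
  have eqV: "exp (\<phi> w) = cmod w powr (\<kappa> - real m) * cmod (V w)" if w: "w \<in> ball 0 1 - {0}" for w
  proof -
    have "cmod w powr \<kappa> = cmod w powr (\<kappa> - real m) * cmod w ^ m"
      using w by (simp add: powr_diff powr_realpow)
    thus ?thesis using mod[of w] V(2)[OF w] w by (simp add: D norm_mult norm_power)
  qed
  show ?thesis
  proof (cases "V 0 = 0")
    case False
    hence "flat_density \<phi> (\<kappa> - real m) V 1"
      using V(1) eqV by (simp add: flat_density_def)
    thus ?thesis by blast
  next
    case True
    have half: "of_real (1/2) \<in> ball 0 1 - {0::complex}" by simp
    have "V (of_real (1/2)) \<noteq> 0" using eqV[OF half] by (metis exp_not_eq_zero mult_zero_right norm_zero)
    hence "\<not> V constant_on ball 0 1"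
      using True half unfolding constant_on_def by (metis DiffD1 centre_in_ball zero_less_one)
    then obtain g r n where g: "0 < n" "0 < r" "ball 0 r \<subseteq> ball (0::complex) 1" "g holomorphic_on ball 0 r"
        "\<And>w. w \<in> ball 0 r \<Longrightarrow> V w = (w - 0) ^ n * g w" "\<And>w. w \<in> ball 0 r \<Longrightarrow> g w \<noteq> 0"
      using holomorphic_factor_zero_nonconstant[OF V(1) open_ball connected_ball _ True] by (metis centre_in_ball zero_less_one)
    have "exp (\<phi> w) = cmod w powr (\<kappa> - real m + real n) * cmod (g w)" if w: "w \<in> ball 0 r - {0}" for w
    proof -
      have "w \<in> ball 0 1 - {0}" using w g(3) by blast
      moreover have "cmod (V w) = cmod w ^ n * cmod (g w)"
        using g(5)[of w] w by (simp add: norm_mult norm_power)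
      ultimately show ?thesis using eqV w by (simp add: powr_add powr_realpow)
    qed
    hence "flat_density \<phi> (\<kappa> - real m + real n) g r"
      using g by (simp add: flat_density_def)
    thus ?thesis by blast
  qed
qed

section \<open>Uniqueness of the density\<close>

lemma flat_density_nonzero: "flat_density \<phi> s u \<epsilon> \<Longrightarrow> w \<in> ball 0 \<epsilon> \<Longrightarrow> u w \<noteq> 0"
  unfolding flat_density_def by (cases "w = 0") (auto, metis exp_not_eq_zero insert_Diff insert_iff mem_ball_0 mult_zero_right norm_zero)

text \<open>If \<open>s > s'\<close>, then \<open>|u'| = |w|\<^bsup>s - s'\<^esup> |u|\<close> would tend to \<open>0\<close> at the origin.\<close>

lemma flat_density_exponent_le:
  assumes 1: "flat_density \<phi> s u \<epsilon>" and 2: "flat_density \<phi> s' u' \<epsilon>'"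
  shows "s \<le> s'"
proof (rule ccontr)
  assume "\<not> s \<le> s'"
  hence t: "s - s' > 0" by simp
  have nz: "u 0 \<noteq> 0" "u' 0 \<noteq> 0" and pos: "0 < \<epsilon>" "0 < \<epsilon>'"
    using 1 2 by (auto simp: flat_density_def)
  have cont: "isCont u 0" "isCont u' 0"
    using 1 2 unfolding flat_density_def
    by (auto intro!: field_differentiable_imp_continuous_at holomorphic_on_imp_differentiable_at[of _ "ball 0 _"])
  have "((\<lambda>w. cmod w powr (s - s') * cmod (u w)) \<longlongrightarrow> 0 * cmod (u 0)) (at 0)"
    by (intro tendsto_mult tendsto_norm) (use cont t in \<open>auto simp: isCont_def intro!: tendsto_zero_powrI tendsto_eq_intros\<close>)
  moreover have "eventually (\<lambda>w. cmod w powr (s - s') * cmod (u w) = cmod (u' w)) (at 0)"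
  proof -
    have "eventually (\<lambda>w. w \<in> ball 0 (min \<epsilon> \<epsilon>') - {0}) (at (0::complex))"
      using pos by (intro eventually_at_in_open) auto
    thus ?thesis
    proof eventually_elim
      case (elim w)
      hence "w \<in> ball 0 \<epsilon> - {0}" "w \<in> ball 0 \<epsilon>' - {0}" by auto
      hence "cmod w powr s * cmod (u w) = cmod w powr s' * cmod (u' w)"
        using 1 2 unfolding flat_density_def by metis
      moreover have "cmod w powr s = cmod w powr s' * cmod w powr (s - s')"
        by (simp add: powr_add[symmetric])
      ultimately show ?case using elim by auto
    qed
  qed
  ultimately have "((\<lambda>w. cmod (u' w)) \<longlongrightarrow> 0) (at 0)"
    by (simp add: tendsto_cong)
  moreover have "((\<lambda>w. cmod (u' w)) \<longlongrightarrow> cmod (u' 0)) (at 0)"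
    using cont by (auto simp: isCont_def intro!: tendsto_intros)
  ultimately have "cmod (u' 0) = 0"
    using tendsto_unique[of "at (0::complex)"] by fastforce
  thus False using nz by simp
qed

text \<open>Two densities of the same metric have a quotient of constant modulus, which is constant by the
maximum principle.\<close>

lemma flat_density_unique:
  assumes 1: "flat_density \<phi> s u \<epsilon>" and 2: "flat_density \<phi> s' u' \<epsilon>'"
  obtains l where "s' = s" "cmod l = 1" "\<And>w. w \<in> ball 0 (min \<epsilon> \<epsilon>') \<Longrightarrow> u' w = l * u w"
proof -
  have s: "s' = s" using flat_density_exponent_le[OF 1 2] flat_density_exponent_le[OF 2 1] by simp
  define r where "r = min \<epsilon> \<epsilon>'"
  have r: "r > 0" "ball 0 r \<subseteq> ball (0::complex) \<epsilon>" "ball 0 r \<subseteq> ball (0::complex) \<epsilon>'"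
    using 1 2 by (auto simp: flat_density_def r_def)
  define h where "h = (\<lambda>w. u' w / u w)"
  have unz: "u w \<noteq> 0" if "w \<in> ball 0 r" for w
    using flat_density_nonzero[OF 1] that r by blast
  have hol: "h holomorphic_on ball 0 r"
    unfolding h_def
    using 1 2 r by (intro holomorphic_on_divide unz) (auto simp: flat_density_def intro: holomorphic_on_subset)
  have norm1: "cmod (h w) = 1" if w: "w \<in> ball 0 r - {0}" for w
  proof -
    have "w \<in> ball 0 \<epsilon> - {0}" "w \<in> ball 0 \<epsilon>' - {0}" using w r by auto
    hence "cmod w powr s * cmod (u w) = cmod w powr s * cmod (u' w)"
      using 1 2 s unfolding flat_density_def by metis
    hence "cmod (u' w) = cmod (u w)" using w by simp
    thus ?thesis using w unz[of w] by (simp add: h_def norm_divide)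
  qed
  have \<xi>: "of_real (r / 2) \<in> ball 0 r - {0::complex}" using r by simp
  have "h constant_on ball 0 r"
  proof (rule maximum_modulus_principle[OF hol open_ball connected_ball _ _ \<xi>])
    show "open (ball 0 r - {0::complex})" by (intro open_Diff) auto
  qed (use norm1 \<xi> in auto)
  then obtain l where l: "\<And>w. w \<in> ball 0 r \<Longrightarrow> h w = l" by (auto simp: constant_on_def)
  have "cmod l = 1" using norm1[OF \<xi>] l \<xi> by (metis DiffD1)
  moreover have "u' w = l * u w" if "w \<in> ball 0 r" for w
    using l[OF that] unz[OF that] by (auto simp: h_def field_simps)
  ultimately show thesis using that s unfolding r_def by blast
qed

section \<open>Differentiation of multivalued powers\<close>

text \<open>In terms of the multivalued function \<open>w\<^sup>\<gamma> q\<close> this is \<open>(w\<^sup>\<gamma> q)' = w\<^bsup>\<gamma> - 1\<^esup> euler \<gamma> q\<close>.\<close>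

definition euler :: "complex \<Rightarrow> (complex \<Rightarrow> complex) \<Rightarrow> complex \<Rightarrow> complex" where
  "euler \<gamma> q w = \<gamma> * q w + w * deriv q w"

lemma has_fps_expansion_euler:
  assumes "q has_fps_expansion Q"
  shows "euler \<gamma> q has_fps_expansion (fps_const \<gamma> * Q + fps_X * fps_deriv Q)"
proof -
  have "(\<lambda>w. \<gamma> * q w + w * deriv q w) has_fps_expansion (fps_const \<gamma> * Q + fps_X * fps_deriv Q)"
    by (intro fps_expansion_intros assms)
  thus ?thesis by (simp add: euler_def[abs_def])
qed

lemma holomorphic_has_fps_expansion_ball:
  assumes "q holomorphic_on ball 0 r" "r > 0"
  shows "q has_fps_expansion fps_expansion q 0"
  using assms by (intro has_fps_expansion_fps_expansion[of "ball 0 r"]) auto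

text \<open>The operator is diagonal on Taylor coefficients. Both its injectivity and its range are read off
from the eigenvalues \<open>\<gamma> + n\<close>.\<close>

lemma fps_nth_euler:
  assumes "q holomorphic_on ball 0 r" "r > 0"
  shows "fps_nth (fps_expansion (euler \<gamma> q) 0) n = (\<gamma> + of_nat n) * fps_nth (fps_expansion q 0) n"
proof -
  have "fps_expansion (euler \<gamma> q) 0 =
      fps_const \<gamma> * fps_expansion q 0 + fps_X * fps_deriv (fps_expansion q 0)"
    by (intro fps_expansion_eqI has_fps_expansion_euler holomorphic_has_fps_expansion_ball[OF assms])
  thus ?thesis
    by (cases n) (simp_all add: fps_eq_iff algebra_simps)
qed

lemma fps_expansion_cong_ball:
  assumes "\<And>w. w \<in> ball 0 r \<Longrightarrow> f w = g w" "r > 0"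
  shows "fps_expansion f 0 = fps_expansion g 0"
proof -
  have "eventually (\<lambda>w. f w = g w) (nhds 0)"
    using assms by (intro eventually_nhds_in_open[of "ball 0 r", THEN eventually_mono]) auto
  thus ?thesis
    by (auto simp: fps_expansion_def fps_eq_iff intro!: higher_deriv_cong_ev)
qed

lemma euler_eq_0_imp_0:
  assumes q: "q holomorphic_on ball 0 r" and \<gamma>: "\<And>k. \<gamma> + of_nat k \<noteq> 0"
    and eq: "\<And>w. w \<in> ball 0 r \<Longrightarrow> euler \<gamma> q w = 0" and w: "w \<in> ball 0 r"
  shows "q w = 0"
proof -
  have r: "r > 0" using w norm_ge_zero[of w] by (simp del: norm_ge_zero)
  have "fps_expansion (euler \<gamma> q) 0 = fps_expansion (\<lambda>_. 0) 0"
    by (rule fps_expansion_cong_ball[OF _ r]) (rule eq)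
  also have "\<dots> = 0" by (intro fps_expansion_eqI has_fps_expansion_0)
  finally have "fps_nth (fps_expansion q 0) n = 0" for n
    using fps_nth_euler[OF q r, of \<gamma> n] \<gamma>[of n] by simp
  hence "fps_expansion q 0 = 0" by (simp add: fps_eq_iff)
  moreover have "eval_fps (fps_expansion q 0) w = q w"
    using has_fps_expansion_imp_eval_fps_eq[OF holomorphic_has_fps_expansion_ball[OF q r] _ q] w by simp
  ultimately show ?thesis by simp
qed

text \<open>Division of the Taylor coefficients by \<open>\<gamma> + k\<close> does not decrease the radius of convergence, since
\<open>1 / (\<gamma> + k)\<close> is bounded. Where \<open>\<gamma> + k\<close> vanishes, the convention \<open>x / 0 = 0\<close> picks the solution
with \<open>k\<close>-th coefficient \<open>0\<close>.\<close>

lemma euler_solvable: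
  assumes u: "u holomorphic_on ball 0 r" and r: "r > 0"
    and \<gamma>: "\<And>k. \<gamma> + of_nat k = 0 \<Longrightarrow> fps_nth (fps_expansion u 0) k = 0"
  obtains q where "q holomorphic_on ball 0 r" "\<And>w. w \<in> ball 0 r \<Longrightarrow> euler \<gamma> q w = u w"
proof -
  define U where "U = fps_expansion u 0"
  define Q where "Q = Abs_fps (\<lambda>k. fps_nth U k / (\<gamma> + of_nat k))"
  have U: "fps_conv_radius U \<ge> r"
    unfolding U_def using u by (intro conv_radius_fps_expansion) simp
  have "filterlim (\<lambda>k. \<gamma> + of_nat k) at_infinity sequentially"
    by (intro tendsto_add_filterlim_at_infinity[OF tendsto_const] tendsto_of_nat)
  hence "(\<lambda>k. 1 / (\<gamma> + of_nat k)) \<longlonglongrightarrow> 0"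
    by (intro tendsto_divide_0[OF tendsto_const])
  hence "Bseq (\<lambda>k. 1 / (\<gamma> + of_nat k))"
    by (intro convergent_imp_Bseq convergentI)
  then obtain C where C: "C > 0" "\<And>k. cmod (1 / (\<gamma> + of_nat k)) \<le> C"
    by (auto simp: Bseq_def)
  have Q: "fps_conv_radius Q \<ge> r"
    unfolding fps_conv_radius_def
  proof (rule conv_radius_geI_ex')
    fix t :: real assume t: "0 < t" "ereal t < ereal r"
    have "summable (\<lambda>k. norm (fps_nth U k * of_real t ^ k))"
      by (rule norm_summable_fps) (use t less_le_trans[OF t(2) U] in simp)
    hence "summable (\<lambda>k. C * norm (fps_nth U k * of_real t ^ k))"
      by (rule summable_mult)
    thus "summable (\<lambda>k. fps_nth Q k * of_real t ^ k)"
    proof (rule summable_comparison_test'[where N = 0])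
      fix k :: nat
      have "norm (fps_nth Q k * of_real t ^ k) =
          cmod (1 / (\<gamma> + of_nat k)) * norm (fps_nth U k * of_real t ^ k)"
        by (simp add: Q_def norm_mult norm_divide)
      also have "\<dots> \<le> C * norm (fps_nth U k * of_real t ^ k)"
        by (intro mult_right_mono C(2)) auto
      finally show "norm (fps_nth Q k * of_real t ^ k) \<le> C * norm (fps_nth U k * of_real t ^ k)" .
    qed
  qed
  have sub: "ball 0 r \<subseteq> eball 0 (fps_conv_radius Q)"
    by (rule ball_eball_mono[OF Q])
  have hol: "eval_fps Q holomorphic_on ball 0 r"
    by (rule holomorphic_on_eval_fps[OF sub])
  have dhol: "euler \<gamma> (eval_fps Q) holomorphic_on ball 0 r"
    unfolding euler_def[abs_def] by (intro holomorphic_intros hol holomorphic_deriv) auto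
  have "fps_conv_radius Q > 0" using Q r by (meson ereal_less(2) less_le_trans)
  hence exp: "eval_fps Q has_fps_expansion Q"
    by (rule eval_fps_has_fps_expansion)
  have "fps_const \<gamma> * Q + fps_X * fps_deriv Q = U"
  proof (rule fps_ext)
    fix k
    have "fps_nth (fps_const \<gamma> * Q + fps_X * fps_deriv Q) k = (\<gamma> + of_nat k) * fps_nth Q k"
      by (cases k) (simp_all add: algebra_simps)
    thus "fps_nth (fps_const \<gamma> * Q + fps_X * fps_deriv Q) k = fps_nth U k"
      using \<gamma>[of k] by (auto simp: Q_def U_def)
  qed
  hence expU: "euler \<gamma> (eval_fps Q) has_fps_expansion U"
    using has_fps_expansion_euler[OF exp, of \<gamma>] by simp
  have "euler \<gamma> (eval_fps Q) w = u w" if "w \<in> ball 0 r" for w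
  proof -
    have "eval_fps U w = u w"
      unfolding U_def
      using has_fps_expansion_imp_eval_fps_eq[OF holomorphic_has_fps_expansion_ball[OF u r] _ u] that by simp
    moreover have "eval_fps U w = euler \<gamma> (eval_fps Q) w"
      using has_fps_expansion_imp_eval_fps_eq[OF expU _ dhol] that by simp
    ultimately show ?thesis by simp
  qed
  thus thesis using that hol by blast
qed

lemma euler_cong:
  assumes "\<And>w. w \<in> ball 0 r \<Longrightarrow> f w = g w" "w \<in> ball 0 r"
  shows "euler \<gamma> f w = euler \<gamma> g w"
proof -
  have "eventually (\<lambda>w. f w = g w) (nhds w)"
    using assms by (intro eventually_nhds_in_open[of "ball 0 r", THEN eventually_mono]) auto
  hence "deriv f w = deriv g w" by (rule deriv_cong_ev) simp
  thus ?thesis using assms by (simp add: euler_def)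
qed

section \<open>Holomorphic coordinates at the origin\<close>

lemma DERIV_mult_exp:
  assumes "a holomorphic_on ball 0 r" "w \<in> ball 0 r"
  shows "((\<lambda>w. w * exp (a w)) has_field_derivative exp (a w) * (1 + w * deriv a w)) (at w)"
proof -
  have "(a has_field_derivative deriv a w) (at w)"
    using assms by (intro holomorphic_derivI[of _ "ball 0 r"]) auto
  thus ?thesis by (auto intro!: derivative_eq_intros simp: algebra_simps)
qed

text \<open>An injective \<open>z\<close> has a simple zero at the origin and no other zero, so \<open>z / w\<close> extends to a function
without zeros on the disk and has a logarithm.\<close>

lemma coordinate_change_exp_form:
  assumes z: "coordinate_change \<epsilon> z" and \<epsilon>: "\<epsilon> > 0"
  obtains a where "a holomorphic_on ball 0 \<epsilon>" "\<And>w. w \<in> ball 0 \<epsilon> \<Longrightarrow> z w = w * exp (a w)"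
proof -
  obtain g where hol: "z holomorphic_on ball 0 \<epsilon>" and z0: "z 0 = 0" and op: "open (z ` ball 0 \<epsilon>)"
    and g: "g holomorphic_on (z ` ball 0 \<epsilon>)" "\<And>w. w \<in> ball 0 \<epsilon> \<Longrightarrow> g (z w) = w"
    using z by (auto simp: coordinate_change_def)
  have "inj_on z (ball 0 \<epsilon>)"
    by (metis g(2) inj_onI)
  hence d0: "deriv z 0 \<noteq> 0"
    using \<epsilon> by (intro holomorphic_injective_imp_regular[OF hol]) auto
  define h where "h = (\<lambda>w. if w = 0 then deriv z 0 else (z w - z 0) / (w - 0))"
  have hh: "h holomorphic_on ball 0 \<epsilon>"
    unfolding h_def by (rule pole_lemma_open[OF hol]) auto
  have hnz: "h w \<noteq> 0" if w: "w \<in> ball 0 \<epsilon>" for w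
  proof (cases "w = 0")
    case False
    hence "z w \<noteq> z 0"
      using g(2)[OF w] g(2)[of 0] \<epsilon> by auto
    thus ?thesis using False z0 by (simp add: h_def)
  qed (use d0 in \<open>simp add: h_def\<close>)
  obtain a where a: "a holomorphic_on ball 0 \<epsilon>" "\<And>w. w \<in> ball 0 \<epsilon> \<Longrightarrow> exp (a w) = h w"
    using holomorphic_logarithm_exists[OF convex_ball open_ball hh hnz, of 0] \<epsilon> by auto
  have "z w = w * exp (a w)" if "w \<in> ball 0 \<epsilon>" for w
    using a(2)[OF that] z0 by (simp add: h_def)
  thus thesis using that a(1) by blast
qed

lemma coordinate_change_mult_exp:
  assumes a: "a holomorphic_on ball 0 r" and r: "r > 0"
  obtains \<epsilon> where "0 < \<epsilon>" "\<epsilon> \<le> r" "\<epsilon> \<le> 1" "coordinate_change \<epsilon> (\<lambda>w. w * exp (a w))"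
proof -
  let ?z = "\<lambda>w. w * exp (a w)"
  have hol: "?z holomorphic_on ball 0 r" by (intro holomorphic_intros a)
  have "deriv ?z 0 = exp (a 0)"
    using DERIV_mult_exp[OF a, of 0] r by (simp add: DERIV_imp_deriv)
  hence "deriv ?z 0 \<noteq> 0" by simp
  with has_complex_derivative_locally_injective[OF hol _ open_ball]
  obtain t where t: "t > 0" "ball 0 t \<subseteq> ball (0::complex) r" "inj_on ?z (ball 0 t)"
    using r by (metis centre_in_ball)
  define \<epsilon> where "\<epsilon> = min (min t r) 1"
  have \<epsilon>: "0 < \<epsilon>" "\<epsilon> \<le> t" "\<epsilon> \<le> r" "\<epsilon> \<le> 1" using t r by (auto simp: \<epsilon>_def)
  have sub: "ball 0 \<epsilon> \<subseteq> ball 0 t" "ball 0 \<epsilon> \<subseteq> ball (0::complex) r" using \<epsilon> by auto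
  have hol': "?z holomorphic_on ball 0 \<epsilon>"
    using hol sub(2) holomorphic_on_subset by blast
  have inj': "inj_on ?z (ball 0 \<epsilon>)"
    using t(3) sub(1) inj_on_subset by blast
  obtain g where "g holomorphic_on (?z ` ball 0 \<epsilon>)" "\<And>w. w \<in> ball 0 \<epsilon> \<Longrightarrow> g (?z w) = w"
    using holomorphic_has_inverse[OF hol' open_ball inj'] by metis
  moreover have "open (?z ` ball 0 \<epsilon>)"
    by (rule open_mapping_thm3[OF hol' open_ball inj'])
  ultimately have "coordinate_change \<epsilon> ?z"
    unfolding coordinate_change_def using hol' by auto
  thus thesis using that \<epsilon> by blast
qed

lemma coordinate_change_cmult:
  assumes "coordinate_change \<epsilon> z" "p \<noteq> 0"
  shows "coordinate_change \<epsilon> (\<lambda>w. p * z w)"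
proof -
  obtain g where z: "z holomorphic_on ball 0 \<epsilon>" "z 0 = 0" "open (z ` ball 0 \<epsilon>)"
    and g: "g holomorphic_on (z ` ball 0 \<epsilon>)" "\<And>w. w \<in> ball 0 \<epsilon> \<Longrightarrow> g (z w) = w"
    using assms(1) by (auto simp: coordinate_change_def)
  have img: "(\<lambda>w. p * z w) ` ball 0 \<epsilon> = (*) p ` (z ` ball 0 \<epsilon>)" by auto
  have "open ((*) p ` (z ` ball 0 \<epsilon>))"
    by (rule open_mapping_thm3[OF _ z(3)]) (use assms(2) in \<open>auto intro!: holomorphic_intros simp: inj_on_def\<close>)
  moreover have "(\<lambda>\<zeta>. g (\<zeta> / p)) holomorphic_on ((*) p ` (z ` ball 0 \<epsilon>))"
    by (rule holomorphic_on_compose_gen[OF _ g(1), unfolded o_def])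
       (use assms(2) in \<open>auto intro!: holomorphic_intros\<close>)
  ultimately show ?thesis
    unfolding coordinate_change_def img
    using z g assms(2) by (auto intro!: holomorphic_intros exI[of _ "\<lambda>\<zeta>. g (\<zeta> / p)"])
qed

section \<open>Densities of the normal forms\<close>

text \<open>For \<open>z = w e\<^sup>a\<close> the forms \<open>(\<beta> + 1) z\<^sup>\<beta> dz\<close>, \<open>c z\<^bsup>-1\<^esup> dz\<close> and \<open>(\<nu> / z - n / z\<^bsup>n + 1\<^esup>) dz\<close> equal
\<open>w\<^sup>s u dw\<close> with \<open>s = \<beta>\<close>, \<open>-1\<close> and \<open>- n - 1\<close>, where \<open>u\<close> is given by the following three functions of \<open>a\<close>.\<close>

definition form1_density :: "real \<Rightarrow> (complex \<Rightarrow> complex) \<Rightarrow> complex \<Rightarrow> complex" where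
  "form1_density \<beta> a w = of_real (\<beta> + 1) * exp (of_real (\<beta> + 1) * a w) * (1 + w * deriv a w)"

definition form2_density :: "real \<Rightarrow> (complex \<Rightarrow> complex) \<Rightarrow> complex \<Rightarrow> complex" where
  "form2_density c a w = of_real c * (1 + w * deriv a w)"

definition form3_density :: "real \<Rightarrow> nat \<Rightarrow> (complex \<Rightarrow> complex) \<Rightarrow> complex \<Rightarrow> complex" where
  "form3_density \<nu> n a w =
     (of_real \<nu> * w ^ n - of_nat n * exp (- of_nat n * a w)) * (1 + w * deriv a w)"

lemma holomorphic_on_form_densities:
  assumes "a holomorphic_on ball 0 r"
  shows "form1_density \<beta> a holomorphic_on ball 0 r" "form2_density c a holomorphic_on ball 0 r"
    "form3_density \<nu> n a holomorphic_on ball 0 r"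
  unfolding form1_density_def[abs_def] form2_density_def[abs_def] form3_density_def[abs_def]
  by (intro holomorphic_intros assms holomorphic_deriv open_ball)+

text \<open>This expresses that \<open>z\<^bsup>\<beta> + 1\<^esup> = w\<^bsup>\<beta> + 1\<^esup> e\<^bsup>(\<beta> + 1) a\<^esup>\<close> is a primitive of the form.\<close>

lemma form1_density_eq_euler:
  assumes "a holomorphic_on ball 0 r" "w \<in> ball 0 r"
  shows "form1_density \<beta> a w = euler (of_real (\<beta> + 1)) (\<lambda>w. exp (of_real (\<beta> + 1) * a w)) w"
proof -
  have "(a has_field_derivative deriv a w) (at w)"
    using assms by (intro holomorphic_derivI[of _ "ball 0 r"]) auto
  hence "((\<lambda>w. exp (of_real (\<beta> + 1) * a w)) has_field_derivative
      exp (of_real (\<beta> + 1) * a w) * (of_real (\<beta> + 1) * deriv a w)) (at w)"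
    by (auto intro!: derivative_eq_intros)
  thus ?thesis
    by (simp add: euler_def form1_density_def DERIV_imp_deriv algebra_simps)
qed

text \<open>The form has the primitive \<open>\<nu> log z + z\<^bsup>-n\<^esup> = \<nu> log w + w\<^bsup>-n\<^esup> (e\<^bsup>-n a\<^esup> + \<nu> w\<^sup>n a)\<close>. The first summand
accounts for the term \<open>\<nu> w\<^sup>n\<close>, which is the residue.\<close>

lemma form3_density_eq_euler:
  assumes "a holomorphic_on ball 0 r" "w \<in> ball 0 r" "n \<ge> 1"
  shows "form3_density \<nu> n a w = of_real \<nu> * w ^ n +
    euler (- of_nat n) (\<lambda>w. exp (- of_nat n * a w) + of_real \<nu> * w ^ n * a w) w"
proof -
  have "(a has_field_derivative deriv a w) (at w)"
    using assms by (intro holomorphic_derivI[of _ "ball 0 r"]) auto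
  hence "((\<lambda>w. exp (- of_nat n * a w) + of_real \<nu> * w ^ n * a w) has_field_derivative
      exp (- of_nat n * a w) * (- of_nat n * deriv a w) +
      of_real \<nu> * (of_nat n * w ^ (n - 1) * a w + w ^ n * deriv a w)) (at w)"
    by (auto intro!: derivative_eq_intros simp: algebra_simps)
  moreover have wn: "w * w ^ (n - 1) = w ^ n" using assms(3) by (cases n) auto
  have "w * (of_real \<nu> * (of_nat n * w ^ (n - 1) * a w + w ^ n * deriv a w)) =
      of_real \<nu> * (of_nat n * w ^ n * a w + w * w ^ n * deriv a w)"
    by (simp add: algebra_simps wn[symmetric] del: One_nat_def)
  ultimately show ?thesis
    by (simp only: euler_def form3_density_def DERIV_imp_deriv distrib_left[of w]) (simp add: algebra_simps)
qed

lemma pullback_form1: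
  fixes w A d :: complex and \<beta> :: real
  assumes "w \<noteq> 0"
  shows "(\<beta> + 1)\<^sup>2 * cmod (w * exp A) powr (2 * \<beta>) * (cmod (exp A * d))\<^sup>2 =
    (cmod w powr \<beta> * cmod (of_real (\<beta> + 1) * exp (of_real (\<beta> + 1) * A) * d))\<^sup>2"
proof -
  have "cmod (w * exp A) powr (2 * \<beta>) = (cmod w powr \<beta>)\<^sup>2 * (exp (\<beta> * Re A))\<^sup>2"
    by (simp add: norm_mult powr_mult exp_powr_real power2_eq_square powr_add[symmetric]
        exp_add[symmetric] algebra_simps)
  moreover have "cmod (exp (of_real (\<beta> + 1) * A)) = exp (\<beta> * Re A) * exp (Re A)"
    by (simp add: exp_add[symmetric] algebra_simps)
  moreover have "(cmod (of_real (\<beta> + 1)))\<^sup>2 = (\<beta> + 1)\<^sup>2"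
    unfolding norm_of_real by simp
  ultimately show ?thesis
    by (simp add: norm_mult power_mult_distrib)
qed

lemma pullback_form2:
  fixes w A d :: complex and c :: real
  assumes "w \<noteq> 0"
  shows "c\<^sup>2 * cmod (w * exp A) powi (-2) * (cmod (exp A * d))\<^sup>2 =
    (cmod w powr (-1) * cmod (of_real c * d))\<^sup>2"
  using assms
  by (simp add: norm_mult power_mult_distrib power_int_minus powr_minus field_simps)

lemma pullback_form3:
  fixes w A d :: complex and \<nu> :: real and n :: nat
  assumes "w \<noteq> 0"
  shows "(cmod (of_real \<nu> / (w * exp A) - of_nat n / (w * exp A) ^ (n + 1)))\<^sup>2 * (cmod (exp A * d))\<^sup>2 =
    (cmod w powr (- real n - 1) * cmod ((of_real \<nu> * w ^ n - of_nat n * exp (- of_nat n * A)) * d))\<^sup>2"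
proof -
  have e: "exp (- of_nat n * A) * exp A ^ n = 1"
    by (simp add: exp_of_nat_mult[symmetric] exp_add[symmetric])
  have "(of_real \<nu> / (w * exp A) - of_nat n / (w * exp A) ^ (n + 1)) * (exp A * d) * w ^ (n + 1) =
      (of_real \<nu> * w ^ n - of_nat n * (1 / exp A ^ n)) * d"
    using assms by (simp add: field_simps)
  also have "1 / exp A ^ n = exp (- of_nat n * A)"
    using e by (simp add: field_simps)
  finally have "(of_real \<nu> / (w * exp A) - of_nat n / (w * exp A) ^ (n + 1)) * (exp A * d) =
      (of_real \<nu> * w ^ n - of_nat n * exp (- of_nat n * A)) * d / w ^ (n + 1)"
    using assms by (simp add: field_simps del: power_Suc power_add add_Suc_right)
  hence "cmod ((of_real \<nu> / (w * exp A) - of_nat n / (w * exp A) ^ (n + 1)) * (exp A * d)) =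
      cmod ((of_real \<nu> * w ^ n - of_nat n * exp (- of_nat n * A)) * d) / cmod w ^ (n + 1)"
    by (simp only: norm_divide norm_power)
  moreover have "cmod w powr (- real n - 1) = 1 / cmod w ^ (n + 1)"
  proof -
    have "cmod w powr (- real n - 1) = cmod w powr (- real (n + 1))"
      by (intro arg_cong2[of _ _ _ _ "(powr)"]) auto
    also have "\<dots> = 1 / cmod w powr real (n + 1)"
      by (simp only: powr_minus inverse_eq_divide)
    also have "cmod w powr real (n + 1) = cmod w ^ (n + 1)"
      by (rule powr_realpow) (use assms in simp)
    finally show ?thesis .
  qed
  ultimately show ?thesis
    unfolding norm_mult power_mult_distrib[symmetric] by simp
qed

text \<open>A reduction common to the three normal forms: once the pulled back density is known pointwise, being
in normal form is an identity between positive functions, from which the square root can be taken.\<close>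

lemma has_form_iff_density:
  assumes \<epsilon>: "0 < \<epsilon>" "\<epsilon> \<le> 1" and z: "coordinate_change \<epsilon> z" and a: "a holomorphic_on ball 0 \<epsilon>"
    and za: "\<And>w. w \<in> ball 0 \<epsilon> \<Longrightarrow> z w = w * exp (a w)"
    and pullback: "\<And>w. w \<noteq> 0 \<Longrightarrow>
      \<rho> (w * exp (a w)) * (cmod (exp (a w) * (1 + w * deriv a w)))\<^sup>2 = (cmod w powr s * cmod (u w))\<^sup>2"
  shows "has_form \<phi> \<rho> \<epsilon> z \<longleftrightarrow> (\<forall>w\<in>ball 0 \<epsilon> - {0}. exp (\<phi> w) = cmod w powr s * cmod (u w))"
proof -
  have "exp (2 * \<phi> w) = \<rho> (z w) * (cmod (deriv z w))\<^sup>2 \<longleftrightarrow> exp (\<phi> w) = cmod w powr s * cmod (u w)"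
    if w: "w \<in> ball 0 \<epsilon> - {0}" for w
  proof -
    have "eventually (\<lambda>w. z w = w * exp (a w)) (nhds w)"
      using za w by (intro eventually_nhds_in_open[of "ball 0 \<epsilon>", THEN eventually_mono]) auto
    hence "deriv z w = deriv (\<lambda>w. w * exp (a w)) w" by (rule deriv_cong_ev) simp
    also have "\<dots> = exp (a w) * (1 + w * deriv a w)"
      using DERIV_mult_exp[OF a, of w] w by (simp add: DERIV_imp_deriv)
    finally have "\<rho> (z w) * (cmod (deriv z w))\<^sup>2 = (cmod w powr s * cmod (u w))\<^sup>2"
      using za[of w] pullback[of w] w by simp
    moreover have "exp (2 * \<phi> w) = (exp (\<phi> w))\<^sup>2"
      by (simp add: exp_double)
    ultimately show ?thesis
      by (simp add: power2_eq_iff_nonneg)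
  qed
  thus ?thesis using assms by (simp add: has_form_def)
qed

lemma has_form1_iff:
  assumes "0 < \<epsilon>" "\<epsilon> \<le> 1" "coordinate_change \<epsilon> z" "a holomorphic_on ball 0 \<epsilon>"
    and "\<And>w. w \<in> ball 0 \<epsilon> \<Longrightarrow> z w = w * exp (a w)"
  shows "has_form \<phi> (\<lambda>\<zeta>. (\<beta> + 1)\<^sup>2 * cmod \<zeta> powr (2 * \<beta>)) \<epsilon> z \<longleftrightarrow>
    (\<forall>w\<in>ball 0 \<epsilon> - {0}. exp (\<phi> w) = cmod w powr \<beta> * cmod (form1_density \<beta> a w))"
  by (rule has_form_iff_density[OF assms]) (assumption, simp only: form1_density_def, rule pullback_form1)

lemma has_form2_iff:
  assumes "0 < \<epsilon>" "\<epsilon> \<le> 1" "coordinate_change \<epsilon> z" "a holomorphic_on ball 0 \<epsilon>"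
    and "\<And>w. w \<in> ball 0 \<epsilon> \<Longrightarrow> z w = w * exp (a w)"
  shows "has_form \<phi> (\<lambda>\<zeta>. c\<^sup>2 * cmod \<zeta> powi (-2)) \<epsilon> z \<longleftrightarrow>
    (\<forall>w\<in>ball 0 \<epsilon> - {0}. exp (\<phi> w) = cmod w powr (-1) * cmod (form2_density c a w))"
  by (rule has_form_iff_density[OF assms]) (assumption, simp only: form2_density_def, rule pullback_form2)

lemma has_form3_iff:
  assumes "0 < \<epsilon>" "\<epsilon> \<le> 1" "coordinate_change \<epsilon> z" "a holomorphic_on ball 0 \<epsilon>"
    and "\<And>w. w \<in> ball 0 \<epsilon> \<Longrightarrow> z w = w * exp (a w)"
  shows "has_form \<phi> (\<lambda>\<zeta>. (cmod (of_real \<nu> / \<zeta> - of_nat n / \<zeta> ^ (n + 1)))\<^sup>2) \<epsilon> z \<longleftrightarrow>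
    (\<forall>w\<in>ball 0 \<epsilon> - {0}. exp (\<phi> w) = cmod w powr (- real n - 1) * cmod (form3_density \<nu> n a w))"
  by (rule has_form_iff_density[OF assms]) (assumption, simp only: form3_density_def, rule pullback_form3)

lemma form1_imp_density:
  assumes "form1 \<phi> \<beta> \<epsilon> z"
  obtains a where "a holomorphic_on ball 0 \<epsilon>" "\<And>w. w \<in> ball 0 \<epsilon> \<Longrightarrow> z w = w * exp (a w)"
    "flat_density \<phi> \<beta> (form1_density \<beta> a) \<epsilon>"
proof -
  have \<beta>: "\<beta> \<noteq> -1" and h: "has_form \<phi> (\<lambda>\<zeta>. (\<beta> + 1)\<^sup>2 * cmod \<zeta> powr (2 * \<beta>)) \<epsilon> z"
    using assms by (auto simp: form1_def)
  have \<epsilon>: "0 < \<epsilon>" "\<epsilon> \<le> 1" "coordinate_change \<epsilon> z" using h by (auto simp: has_form_def)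
  obtain a where a: "a holomorphic_on ball 0 \<epsilon>" "\<And>w. w \<in> ball 0 \<epsilon> \<Longrightarrow> z w = w * exp (a w)"
    using coordinate_change_exp_form \<epsilon> by metis
  have "\<forall>w\<in>ball 0 \<epsilon> - {0}. exp (\<phi> w) = cmod w powr \<beta> * cmod (form1_density \<beta> a w)"
    using h has_form1_iff[OF \<epsilon> a] by blast
  moreover have "\<beta> + 1 \<noteq> 0" using \<beta> by simp
  hence "form1_density \<beta> a 0 \<noteq> 0" unfolding form1_density_def by (simp del: of_real_add)
  ultimately have "flat_density \<phi> \<beta> (form1_density \<beta> a) \<epsilon>"
    using \<epsilon> holomorphic_on_form_densities[OF a(1)] by (simp add: flat_density_def)
  thus thesis using that a by blast
qed

lemma form2_imp_density:
  assumes "form2 \<phi> c \<epsilon> z"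
  obtains a where "a holomorphic_on ball 0 \<epsilon>" "\<And>w. w \<in> ball 0 \<epsilon> \<Longrightarrow> z w = w * exp (a w)"
    "flat_density \<phi> (-1) (form2_density c a) \<epsilon>"
proof -
  have c: "c > 0" and h: "has_form \<phi> (\<lambda>\<zeta>. c\<^sup>2 * cmod \<zeta> powi (-2)) \<epsilon> z"
    using assms by (auto simp: form2_def)
  have \<epsilon>: "0 < \<epsilon>" "\<epsilon> \<le> 1" "coordinate_change \<epsilon> z" using h by (auto simp: has_form_def)
  obtain a where a: "a holomorphic_on ball 0 \<epsilon>" "\<And>w. w \<in> ball 0 \<epsilon> \<Longrightarrow> z w = w * exp (a w)"
    using coordinate_change_exp_form \<epsilon> by metis
  have "\<forall>w\<in>ball 0 \<epsilon> - {0}. exp (\<phi> w) = cmod w powr (-1) * cmod (form2_density c a w)"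
    using h has_form2_iff[OF \<epsilon> a] by blast
  moreover have "form2_density c a 0 \<noteq> 0" using c by (simp add: form2_density_def)
  ultimately have "flat_density \<phi> (-1) (form2_density c a) \<epsilon>"
    using \<epsilon> holomorphic_on_form_densities[OF a(1)] by (simp add: flat_density_def)
  thus thesis using that a by blast
qed

lemma form3_imp_density:
  assumes "form3 \<phi> \<nu> n \<epsilon> z"
  obtains a where "a holomorphic_on ball 0 \<epsilon>" "flat_density \<phi> (- real n - 1) (form3_density \<nu> n a) \<epsilon>"
proof -
  have n: "n \<ge> 1"
    and h: "has_form \<phi> (\<lambda>\<zeta>. (cmod (of_real \<nu> / \<zeta> - of_nat n / \<zeta> ^ (n + 1)))\<^sup>2) \<epsilon> z"
    using assms by (auto simp: form3_def)
  have \<epsilon>: "0 < \<epsilon>" "\<epsilon> \<le> 1" "coordinate_change \<epsilon> z" using h by (auto simp: has_form_def)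
  obtain a where a: "a holomorphic_on ball 0 \<epsilon>" "\<And>w. w \<in> ball 0 \<epsilon> \<Longrightarrow> z w = w * exp (a w)"
    using coordinate_change_exp_form \<epsilon> by metis
  have "\<forall>w\<in>ball 0 \<epsilon> - {0}. exp (\<phi> w) = cmod w powr (- real n - 1) * cmod (form3_density \<nu> n a w)"
    using h has_form3_iff[OF \<epsilon> a] by blast
  moreover have "form3_density \<nu> n a 0 \<noteq> 0" using n by (simp add: form3_density_def zero_power)
  ultimately have "flat_density \<phi> (- real n - 1) (form3_density \<nu> n a) \<epsilon>"
    using \<epsilon> holomorphic_on_form_densities[OF a(1)] by (simp add: flat_density_def)
  thus thesis using that a by blast
qed

lemma density_imp_form1:
  assumes "\<beta> \<noteq> -1" and a: "a holomorphic_on ball 0 r" and r: "0 < r"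
    and eq: "\<forall>w\<in>ball 0 r - {0}. exp (\<phi> w) = cmod w powr \<beta> * cmod (form1_density \<beta> a w)"
  shows "\<exists>\<epsilon> z. form1 \<phi> \<beta> \<epsilon> z"
proof -
  obtain \<epsilon> where \<epsilon>: "0 < \<epsilon>" "\<epsilon> \<le> r" "\<epsilon> \<le> 1" "coordinate_change \<epsilon> (\<lambda>w. w * exp (a w))"
    using coordinate_change_mult_exp[OF a r] by blast
  have sub: "ball 0 \<epsilon> \<subseteq> ball (0::complex) r" using \<epsilon> by auto
  have "a holomorphic_on ball 0 \<epsilon>" using a sub holomorphic_on_subset by blast
  from has_form1_iff[OF \<epsilon>(1,3,4) this refl]
  show ?thesis using assms(1) eq sub unfolding form1_def by blast
qed

lemma density_imp_form2:
  assumes "c > 0" and a: "a holomorphic_on ball 0 r" and r: "0 < r"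
    and eq: "\<forall>w\<in>ball 0 r - {0}. exp (\<phi> w) = cmod w powr (-1) * cmod (form2_density c a w)"
  shows "\<exists>\<epsilon> z. form2 \<phi> c \<epsilon> z"
proof -
  obtain \<epsilon> where \<epsilon>: "0 < \<epsilon>" "\<epsilon> \<le> r" "\<epsilon> \<le> 1" "coordinate_change \<epsilon> (\<lambda>w. w * exp (a w))"
    using coordinate_change_mult_exp[OF a r] by blast
  have sub: "ball 0 \<epsilon> \<subseteq> ball (0::complex) r" using \<epsilon> by auto
  have "a holomorphic_on ball 0 \<epsilon>" using a sub holomorphic_on_subset by blast
  from has_form2_iff[OF \<epsilon>(1,3,4) this refl]
  show ?thesis using assms(1) eq sub unfolding form2_def by blast
qed

lemma density_imp_form3:
  assumes "\<nu> > 0" "n \<ge> 1" and a: "a holomorphic_on ball 0 r" and r: "0 < r"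
    and eq: "\<forall>w\<in>ball 0 r - {0}. exp (\<phi> w) = cmod w powr (- real n - 1) * cmod (form3_density \<nu> n a w)"
  shows "\<exists>\<epsilon> z. form3 \<phi> \<nu> n \<epsilon> z"
proof -
  obtain \<epsilon> where \<epsilon>: "0 < \<epsilon>" "\<epsilon> \<le> r" "\<epsilon> \<le> 1" "coordinate_change \<epsilon> (\<lambda>w. w * exp (a w))"
    using coordinate_change_mult_exp[OF a r] by blast
  have sub: "ball 0 \<epsilon> \<subseteq> ball (0::complex) r" using \<epsilon> by auto
  have "a holomorphic_on ball 0 \<epsilon>" using a sub holomorphic_on_subset by blast
  from has_form3_iff[OF \<epsilon>(1,3,4) this refl]
  show ?thesis using assms(1,2) eq sub unfolding form3_def by blast
qed

section \<open>Uniqueness of constants and coordinates\<close>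

text \<open>The residue of \<open>(\<nu> / z - n / z\<^bsup>n + 1\<^esup>) dz\<close> is \<open>\<nu>\<close> in every coordinate, because the rest of the density is
in the range of \<open>euler (-n)\<close>, whose \<open>n\<close>-th coefficients vanish.\<close>

lemma fps_nth_form3_density:
  assumes a: "a holomorphic_on ball 0 r" and r: "r > 0" and n: "n \<ge> 1"
  shows "fps_nth (fps_expansion (form3_density \<nu> n a) 0) n = of_real \<nu>"
proof -
  define \<psi> where "\<psi> = (\<lambda>w. exp (- of_nat n * a w) + of_real \<nu> * w ^ n * a w)"
  have \<psi>: "\<psi> holomorphic_on ball 0 r" unfolding \<psi>_def by (intro holomorphic_intros a)
  have e: "euler (- of_nat n) \<psi> holomorphic_on ball 0 r"
    unfolding euler_def[abs_def] by (intro holomorphic_intros \<psi> holomorphic_deriv) auto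
  have "fps_expansion (form3_density \<nu> n a) 0 =
      fps_expansion (\<lambda>w. of_real \<nu> * w ^ n + euler (- of_nat n) \<psi> w) 0"
    by (rule fps_expansion_cong_ball[OF _ r]) (simp only: \<psi>_def form3_density_eq_euler[OF a _ n])
  also have "\<dots> = fps_const (of_real \<nu>) * fps_X ^ n + fps_expansion (euler (- of_nat n) \<psi>) 0"
    by (intro fps_expansion_eqI fps_expansion_intros holomorphic_has_fps_expansion_ball[OF e r])
  finally show ?thesis
    using fps_nth_euler[OF \<psi> r, of "- of_nat n" n] by simp
qed

lemma form1_exponent_unique:
  assumes "form1 \<phi> \<beta> \<epsilon> z" "form1 \<phi> \<beta>' \<epsilon>' z'"
  shows "\<beta>' = \<beta>"
  using form1_imp_density[OF assms(1)] form1_imp_density[OF assms(2)] flat_density_unique by metis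

lemma form2_constant_unique:
  assumes "form2 \<phi> c \<epsilon> z" "form2 \<phi> c' \<epsilon>' z'"
  shows "c' = c"
proof -
  have pos: "c > 0" "c' > 0" "\<epsilon> > 0" "\<epsilon>' > 0" using assms by (auto simp: form2_def has_form_def)
  obtain a where a: "flat_density \<phi> (-1) (form2_density c a) \<epsilon>"
    using form2_imp_density[OF assms(1)] by metis
  obtain a' where a': "flat_density \<phi> (-1) (form2_density c' a') \<epsilon>'"
    using form2_imp_density[OF assms(2)] by metis
  obtain l where l: "cmod l = 1" "\<And>w. w \<in> ball 0 (min \<epsilon> \<epsilon>') \<Longrightarrow> form2_density c' a' w = l * form2_density c a w"
    using flat_density_unique[OF a a'] by metis
  have "cmod (form2_density c' a' 0) = cmod (l * form2_density c a 0)"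
    using l(2)[of 0] pos by simp
  thus ?thesis using l(1) pos by (simp add: form2_density_def norm_mult)
qed

text \<open>The order of the pole is \<open>n + 1\<close>. The residue \<open>\<nu>\<close> is determined up to a unimodular factor, hence
determined, being positive.\<close>

lemma form3_constants_unique:
  assumes "form3 \<phi> \<nu> n \<epsilon> z" "form3 \<phi> \<nu>' n' \<epsilon>' z'"
  shows "n' = n \<and> \<nu>' = \<nu>"
proof -
  have pos: "\<nu> > 0" "\<nu>' > 0" "n \<ge> 1" "n' \<ge> 1" "\<epsilon> > 0" "\<epsilon>' > 0"
    using assms by (auto simp: form3_def has_form_def)
  obtain a where a: "a holomorphic_on ball 0 \<epsilon>" "flat_density \<phi> (- real n - 1) (form3_density \<nu> n a) \<epsilon>"
    using form3_imp_density[OF assms(1)] by metis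
  obtain a' where a': "a' holomorphic_on ball 0 \<epsilon>'" "flat_density \<phi> (- real n' - 1) (form3_density \<nu>' n' a') \<epsilon>'"
    using form3_imp_density[OF assms(2)] by metis
  obtain l where n': "n' = n" and l: "cmod l = 1"
    "\<And>w. w \<in> ball 0 (min \<epsilon> \<epsilon>') \<Longrightarrow> form3_density \<nu>' n' a' w = l * form3_density \<nu> n a w"
    using flat_density_unique[OF a(2) a'(2)] by auto
  have d: "form3_density \<nu> n a holomorphic_on ball 0 \<epsilon>"
    by (rule holomorphic_on_form_densities(3)[OF a(1)])
  have "fps_expansion (form3_density \<nu>' n' a') 0 = fps_expansion (\<lambda>w. l * form3_density \<nu> n a w) 0"
    by (rule fps_expansion_cong_ball[where r = "min \<epsilon> \<epsilon>'"]) (use l(2) pos in auto)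
  also have "\<dots> = fps_const l * fps_expansion (form3_density \<nu> n a) 0"
    by (intro fps_expansion_eqI fps_expansion_intros holomorphic_has_fps_expansion_ball[OF d] pos)
  finally have "of_real \<nu>' = l * of_real \<nu>"
    using fps_nth_form3_density[OF a'(1) pos(6,4), of \<nu>'] fps_nth_form3_density[OF a(1) pos(5,3), of \<nu>] n' by simp
  hence "cmod (of_real \<nu>') = cmod (l * of_real \<nu>)" by simp
  thus ?thesis using n' l(1) pos by (simp add: norm_mult)
qed

text \<open>The hypothesis \<open>inv\<close> says that \<open>\<zeta> \<mapsto> p \<zeta>\<close> is an isometry of \<open>\<rho> |d\<zeta>|\<^sup>2\<close>.\<close>

lemma has_form_cmult:
  assumes h: "has_form \<phi> \<rho> \<epsilon> z" and p: "p \<noteq> 0"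
    and inv: "\<And>\<zeta>. \<zeta> \<noteq> 0 \<Longrightarrow> \<rho> (p * \<zeta>) * (cmod p)\<^sup>2 = \<rho> \<zeta>"
  shows "has_form \<phi> \<rho> \<epsilon> (\<lambda>w. p * z w)"
proof -
  have z: "coordinate_change \<epsilon> z" and \<epsilon>: "0 < \<epsilon>" "\<epsilon> \<le> 1"
    and eq: "\<And>w. w \<in> ball 0 \<epsilon> - {0} \<Longrightarrow> exp (2 * \<phi> w) = \<rho> (z w) * (cmod (deriv z w))\<^sup>2"
    using h by (auto simp: has_form_def)
  have "exp (2 * \<phi> w) = \<rho> (p * z w) * (cmod (deriv (\<lambda>w. p * z w) w))\<^sup>2" if w: "w \<in> ball 0 \<epsilon> - {0}" for w
  proof -
    have hol: "z holomorphic_on ball 0 \<epsilon>" using z by (simp add: coordinate_change_def)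
    hence "deriv (\<lambda>w. p * z w) w = p * deriv z w"
      using w by (intro deriv_cmult holomorphic_on_imp_differentiable_at[of _ "ball 0 \<epsilon>"]) auto
    moreover have "z w \<noteq> 0"
      using coordinate_change_exp_form[OF z \<epsilon>(1)] w
      by (metis DiffD1 DiffD2 exp_not_eq_zero insertCI mult_eq_0_iff)
    ultimately show ?thesis
      using eq[OF w] inv[of "z w"] by (simp add: norm_mult power_mult_distrib mult_ac)
  qed
  thus ?thesis using coordinate_change_cmult[OF z p] \<epsilon> by (simp add: has_form_def)
qed

lemma form1_rotate:
  assumes "form1 \<phi> \<beta> \<epsilon> z" "cmod l = 1"
  shows "form1 \<phi> \<beta> \<epsilon> (\<lambda>w. l * z w)"
  using assms unfolding form1_def
  by (auto intro!: has_form_cmult simp: norm_mult)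

lemma form2_scale:
  assumes "form2 \<phi> c \<epsilon> z" "p \<noteq> 0"
  shows "form2 \<phi> c \<epsilon> (\<lambda>w. p * z w)"
  using assms unfolding form2_def
  by (auto intro!: has_form_cmult simp: norm_mult power_int_minus field_simps)

text \<open>The functions \<open>q = (z / w)\<^bsup>\<beta> + 1\<^esup>\<close> of the two coordinates have \<open>euler\<close>-images that agree up to a unimodular
factor \<open>l\<close>. The condition on \<open>\<beta>\<close> makes \<open>euler (\<beta> + 1)\<close> injective, so the functions themselves agree up
to \<open>l\<close>, and taking the root shows that \<open>z' / z\<close> is constant.\<close>

lemma form1_coordinate_unique:
  assumes 1: "form1 \<phi> \<beta> \<epsilon> z" and 2: "form1 \<phi> \<beta> \<epsilon>' z'"
    and \<beta>: "\<beta> \<in> ({..< -1} - \<int>) \<union> {-1 <..}"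
  shows "\<exists>l. cmod l = 1 \<and> (\<forall>w\<in>ball 0 (min \<epsilon> \<epsilon>'). z' w = l * z w)"
proof -
  define r where "r = min \<epsilon> \<epsilon>'"
  define \<gamma> where "\<gamma> = complex_of_real (\<beta> + 1)"
  have r: "r > 0" using 1 2 by (auto simp: form1_def has_form_def r_def)
  have sub: "ball 0 r \<subseteq> ball (0::complex) \<epsilon>" "ball 0 r \<subseteq> ball (0::complex) \<epsilon>'"
    by (auto simp: r_def)
  have \<gamma>: "\<gamma> + of_nat k \<noteq> 0" for k
  proof
    assume "\<gamma> + of_nat k = 0"
    hence "complex_of_real (\<beta> + 1 + real k) = 0" by (simp add: \<gamma>_def)
    hence "\<beta> + 1 + real k = 0" by (simp only: of_real_eq_0_iff)
    hence "\<beta> = of_int (- 1 - int k)" by simp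
    moreover from this have "\<beta> \<in> \<int>" by (metis Ints_of_int)
    ultimately show False using \<beta> by auto
  qed
  have \<gamma>0: "\<gamma> \<noteq> 0" using \<gamma>[of 0] by simp
  obtain a where a: "a holomorphic_on ball 0 \<epsilon>" "\<And>w. w \<in> ball 0 \<epsilon> \<Longrightarrow> z w = w * exp (a w)"
    "flat_density \<phi> \<beta> (form1_density \<beta> a) \<epsilon>"
    using form1_imp_density[OF 1] by metis
  obtain a' where a': "a' holomorphic_on ball 0 \<epsilon>'" "\<And>w. w \<in> ball 0 \<epsilon>' \<Longrightarrow> z' w = w * exp (a' w)"
    "flat_density \<phi> \<beta> (form1_density \<beta> a') \<epsilon>'"
    using form1_imp_density[OF 2] by metis
  obtain l where l: "cmod l = 1" "\<And>w. w \<in> ball 0 r \<Longrightarrow> form1_density \<beta> a' w = l * form1_density \<beta> a w"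
    using flat_density_unique[OF a(3) a'(3)] unfolding r_def by metis
  have ha: "a holomorphic_on ball 0 r" "a' holomorphic_on ball 0 r"
    using a(1) a'(1) sub holomorphic_on_subset by blast+
  define q q' where "q = (\<lambda>w. exp (\<gamma> * a w))" and "q' = (\<lambda>w. exp (\<gamma> * a' w))"
  have hq: "q holomorphic_on ball 0 r" "q' holomorphic_on ball 0 r"
    unfolding q_def q'_def by (intro holomorphic_intros ha)+
  have "q' w - l * q w = 0" if w: "w \<in> ball 0 r" for w
  proof (rule euler_eq_0_imp_0[OF _ \<gamma> _ w])
    show "(\<lambda>w. q' w - l * q w) holomorphic_on ball 0 r" by (intro holomorphic_intros hq)
    fix w :: complex assume w: "w \<in> ball 0 r"
    have "(q has_field_derivative deriv q w) (at w)" "(q' has_field_derivative deriv q' w) (at w)"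
      using hq w by (auto intro!: holomorphic_derivI[of _ "ball 0 r"])
    hence "((\<lambda>w. q' w - l * q w) has_field_derivative deriv q' w - l * deriv q w) (at w)"
      by (auto intro!: derivative_eq_intros)
    hence "euler \<gamma> (\<lambda>w. q' w - l * q w) w = euler \<gamma> q' w - l * euler \<gamma> q w"
      by (simp add: euler_def DERIV_imp_deriv algebra_simps)
    also have "\<dots> = form1_density \<beta> a' w - l * form1_density \<beta> a w"
      using form1_density_eq_euler[OF ha(1) w] form1_density_eq_euler[OF ha(2) w] by (simp add: q_def q'_def \<gamma>_def)
    finally show "euler \<gamma> (\<lambda>w. q' w - l * q w) w = 0" using l(2)[OF w] by simp
  qed
  hence e: "exp (\<gamma> * (a' w - a w)) = l" if "w \<in> ball 0 r" for w
    using that by (simp add: q_def q'_def algebra_simps exp_diff)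
  have "((\<lambda>w. a' w - a w) has_field_derivative 0) (at w)" if w: "w \<in> ball 0 r" for w
  proof -
    define d where "d = deriv a' w - deriv a w"
    have "(a has_field_derivative deriv a w) (at w)" "(a' has_field_derivative deriv a' w) (at w)"
      using ha w by (auto intro!: holomorphic_derivI[of _ "ball 0 r"])
    hence D: "((\<lambda>w. a' w - a w) has_field_derivative d) (at w)"
      unfolding d_def by (auto intro!: derivative_eq_intros)
    hence "((\<lambda>w. exp (\<gamma> * (a' w - a w))) has_field_derivative l * (\<gamma> * d)) (at w)"
      using DERIV_chain2[OF DERIV_exp DERIV_cmult[OF D, of \<gamma>]] e[OF w] by simp
    moreover have "((\<lambda>w. exp (\<gamma> * (a' w - a w))) has_field_derivative 0) (at w)"
      by (rule has_field_derivative_transform_within_open[of "\<lambda>_. l" _ _ "ball 0 r"]) (use w e in auto)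
    ultimately have "l * (\<gamma> * d) = 0" by (rule DERIV_unique)
    thus ?thesis using D l(1) \<gamma>0 by auto
  qed
  \<comment> \<open>The factor \<open>z' / z\<close> is \<open>e\<^sup>b\<close>; its \<open>(\<beta> + 1)\<close>-th power is \<open>l\<close>, hence its modulus is \<open>1\<close>.\<close>
  then obtain b where b: "\<And>w. w \<in> ball 0 r \<Longrightarrow> a' w - a w = b"
    using has_field_derivative_zero_constant[OF convex_ball, of 0 r "\<lambda>w. a' w - a w"]
    by (meson at_within_open_subset has_field_derivative_at_within)
  have "exp ((\<beta> + 1) * Re b) = 1"
    using e[of 0] b[of 0] r l(1) by (auto simp: \<gamma>_def)
  hence "Re b = 0" using \<gamma>0 by (auto simp: \<gamma>_def simp del: of_real_add)
  hence "cmod (exp b) = 1" by simp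
  moreover have "z' w = exp b * z w" if w: "w \<in> ball 0 r" for w
  proof -
    have "a' w = b + a w" using b[OF w] by (simp add: algebra_simps)
    moreover have "w \<in> ball 0 \<epsilon>" "w \<in> ball 0 \<epsilon>'" using w sub by auto
    ultimately show ?thesis using a(2) a'(2) by (simp add: exp_add)
  qed
  ultimately show ?thesis unfolding r_def by blast
qed

text \<open>The residue \<open>c\<close> is the value of both densities at the origin, so that they coincide, and \<open>a' - a\<close> has
derivative \<open>0\<close> away from the origin.\<close>

lemma form2_coordinate_unique:
  assumes 1: "form2 \<phi> c \<epsilon> z" and 2: "form2 \<phi> c \<epsilon>' z'"
  shows "\<exists>p. p \<noteq> 0 \<and> (\<forall>w\<in>ball 0 (min \<epsilon> \<epsilon>'). z' w = p * z w)"
proof -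
  define r where "r = min \<epsilon> \<epsilon>'"
  have r: "r > 0" and c: "c > 0" using 1 2 by (auto simp: form2_def has_form_def r_def)
  have sub: "ball 0 r \<subseteq> ball (0::complex) \<epsilon>" "ball 0 r \<subseteq> ball (0::complex) \<epsilon>'"
    by (auto simp: r_def)
  obtain a where a: "a holomorphic_on ball 0 \<epsilon>" "\<And>w. w \<in> ball 0 \<epsilon> \<Longrightarrow> z w = w * exp (a w)"
    "flat_density \<phi> (-1) (form2_density c a) \<epsilon>"
    using form2_imp_density[OF 1] by metis
  obtain a' where a': "a' holomorphic_on ball 0 \<epsilon>'" "\<And>w. w \<in> ball 0 \<epsilon>' \<Longrightarrow> z' w = w * exp (a' w)"
    "flat_density \<phi> (-1) (form2_density c a') \<epsilon>'"
    using form2_imp_density[OF 2] by metis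
  obtain l where l: "\<And>w. w \<in> ball 0 r \<Longrightarrow> form2_density c a' w = l * form2_density c a w"
    using flat_density_unique[OF a(3) a'(3)] unfolding r_def by metis
  have "l = 1" using l[of 0] r c by (simp add: form2_density_def)
  hence d: "w * deriv a' w = w * deriv a w" if "w \<in> ball 0 r" for w
    using l[OF that] c by (simp add: form2_density_def)
  have ha: "a holomorphic_on ball 0 r" "a' holomorphic_on ball 0 r"
    using a(1) a'(1) sub holomorphic_on_subset by blast+
  have D: "((\<lambda>w. a' w - a w) has_field_derivative 0) (at w)" if w: "w \<in> ball 0 r - {0}" for w
  proof -
    have "(a has_field_derivative deriv a w) (at w)" "(a' has_field_derivative deriv a' w) (at w)"
      using ha w by (auto intro!: holomorphic_derivI[of _ "ball 0 r"])
    thus ?thesis using d[of w] w by (auto intro!: derivative_eq_intros)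
  qed
  obtain b where b: "\<And>w. w \<in> ball 0 r \<Longrightarrow> a' w - a w = b"
  proof (rule DERIV_zero_connected_constant[of "ball 0 r" "{0}" "\<lambda>w. a' w - a w"])
    show "continuous_on (ball 0 r) (\<lambda>w. a' w - a w)"
      by (intro continuous_intros holomorphic_on_imp_continuous_on ha)
  qed (use D in auto)
  have "z' w = exp b * z w" if w: "w \<in> ball 0 r" for w
  proof -
    have "a' w = b + a w" using b[OF w] by (simp add: algebra_simps)
    moreover have "w \<in> ball 0 \<epsilon>" "w \<in> ball 0 \<epsilon>'" using w sub by auto
    ultimately show ?thesis using a(2) a'(2) by (simp add: exp_add)
  qed
  thus ?thesis unfolding r_def by (intro exI[of _ "exp b"]) simp
qed

section \<open>A holomorphic implicit equation\<close>

text \<open>The contraction principle with a holomorphic parameter: the iterates of \<open>0\<close> are holomorphic and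
converge uniformly, and a uniform limit of holomorphic functions is holomorphic.\<close>

lemma holomorphic_fixed_point:
  fixes T :: "complex \<Rightarrow> complex \<Rightarrow> complex"
  assumes \<rho>: "\<rho> \<ge> 0"
    and hol: "\<And>f. f holomorphic_on ball 0 r \<Longrightarrow> (\<lambda>w. T w (f w)) holomorphic_on ball 0 r"
    and lip: "\<And>w b b'. w \<in> ball 0 r \<Longrightarrow> cmod b \<le> \<rho> \<Longrightarrow> cmod b' \<le> \<rho> \<Longrightarrow>
      cmod (T w b - T w b') \<le> cmod (b - b') / 2"
    and T0: "\<And>w. w \<in> ball 0 r \<Longrightarrow> cmod (T w 0) \<le> \<rho> / 2"
  obtains f where "f holomorphic_on ball 0 r" "\<And>w. w \<in> ball 0 r \<Longrightarrow> T w (f w) = f w"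
proof -
  define F where "F k = ((\<lambda>f w. T w (f w)) ^^ k) (\<lambda>_. 0)" for k
  have F_Suc: "F (Suc k) w = T w (F k w)" and F_0: "F 0 w = 0" for k w
    by (simp_all add: F_def)
  have F_hol: "F k holomorphic_on ball 0 r" for k
  proof (induction k)
    case (Suc k)
    have "F (Suc k) = (\<lambda>w. T w (F k w))" by (simp add: fun_eq_iff F_Suc)
    thus ?case using hol[OF Suc] by simp
  qed (simp add: F_def)
  have F_le: "cmod (F k w) \<le> \<rho>" if w: "w \<in> ball 0 r" for k w
  proof (induction k)
    case (Suc k)
    have "cmod (T w (F k w)) \<le> cmod (T w (F k w) - T w 0) + cmod (T w 0)"
      by (metis norm_triangle_sub add.commute)
    also have "\<dots> \<le> cmod (F k w) / 2 + \<rho> / 2"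
      using lip[OF w Suc, of 0] \<rho> T0[OF w] by (intro add_mono) auto
    also have "\<dots> \<le> \<rho>" using Suc by simp
    finally show ?case by (simp add: F_Suc)
  qed (use \<rho> in \<open>simp add: F_0\<close>)
  have step: "cmod (F (Suc k) w - F k w) \<le> \<rho> * (1 / 2) ^ k" if w: "w \<in> ball 0 r" for k w
  proof (induction k)
    case 0
    thus ?case using F_le[OF w, of 1] by (simp add: F_0)
  next
    case (Suc k)
    have "cmod (F (Suc (Suc k)) w - F (Suc k) w) \<le> cmod (F (Suc k) w - F k w) / 2"
      unfolding F_Suc[of "Suc k"] F_Suc[of k w] using lip[OF w F_le[OF w, of "Suc k"] F_le[OF w, of k]]
      by (simp add: F_Suc)
    thus ?case using Suc by simp
  qed
  define f where "f w = (\<Sum>k. F (Suc k) w - F k w)" for w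
  have unif: "uniform_limit (ball 0 r) (\<lambda>n w. \<Sum>k<n. F (Suc k) w - F k w) f sequentially"
    unfolding f_def
    by (rule Weierstrass_m_test[where M = "\<lambda>k. \<rho> * (1 / 2) ^ k"])
       (use step in \<open>auto intro!: summable_mult summable_geometric\<close>)
  have "(\<lambda>n w. \<Sum>k<n. F (Suc k) w - F k w) = F"
    by (intro ext) (simp only: sum_lessThan_telescope[of "\<lambda>k. F k _"], simp add: F_0)
  with unif have unif: "uniform_limit (ball 0 r) F f sequentially" by simp
  have f_hol: "f holomorphic_on ball 0 r"
  proof (rule holomorphic_uniform_sequence[OF open_ball F_hol])
    fix x :: complex assume "x \<in> ball 0 r"
    then obtain d where "d > 0" "cball x d \<subseteq> ball 0 r"
      using open_contains_cball open_ball by blast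
    thus "\<exists>d>0. cball x d \<subseteq> ball 0 r \<and> uniform_limit (cball x d) F f sequentially"
      using uniform_limit_on_subset[OF unif] by blast
  qed
  have "T w (f w) = f w" if w: "w \<in> ball 0 r" for w
  proof -
    have lim: "(\<lambda>n. F n w) \<longlonglongrightarrow> f w" by (rule tendsto_uniform_limitI[OF unif w])
    have fle: "cmod (f w) \<le> \<rho>"
      by (rule LIMSEQ_le_const2[OF tendsto_norm[OF lim]]) (use F_le[OF w] in auto)
    have "(\<lambda>n. T w (F n w) - T w (f w)) \<longlonglongrightarrow> 0"
    proof (rule Lim_null_comparison)
      show "eventually (\<lambda>n. cmod (T w (F n w) - T w (f w)) \<le> cmod (F n w - f w) / 2) sequentially"
        using lip[OF w F_le[OF w] fle] by simp
      show "(\<lambda>n. cmod (F n w - f w) / 2) \<longlonglongrightarrow> 0"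
        using lim by (auto intro!: tendsto_eq_intros)
    qed
    hence "(\<lambda>n. F (Suc n) w) \<longlonglongrightarrow> T w (f w)"
      by (simp add: F_Suc Lim_null[of _ "T w (f w)"])
    moreover have "(\<lambda>n. F (Suc n) w) \<longlonglongrightarrow> f w"
      by (rule LIMSEQ_Suc[OF lim])
    ultimately show ?thesis by (rule LIMSEQ_unique)
  qed
  thus thesis using that f_hol by blast
qed

text \<open>At \<open>w = 0\<close> the equation is \<open>e\<^bsup>-n a\<^esup> = v 0\<close> with solution \<open>a0\<close>. For \<open>a = a0 + b\<close> it is the fixed point
equation of the simplified Newton iteration \<open>T\<close>, which uses the derivative \<open>- n v 0\<close> at \<open>(0, a0)\<close>
for all \<open>w\<close>. The part \<open>E\<close> of \<open>T\<close> has derivative \<open>0\<close> at \<open>b = 0\<close> and the other terms vanish at \<open>w = 0\<close>, so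
\<open>T\<close> is a contraction near \<open>0\<close>.\<close>

lemma holomorphic_exp_implicit:
  fixes \<nu> :: complex
  assumes v: "v holomorphic_on ball 0 r" and r: "r > 0" and v0: "v 0 \<noteq> 0" and n: "n \<ge> 1"
  obtains a t where "0 < t" "t \<le> r" "a holomorphic_on ball 0 t"
    "\<And>w. w \<in> ball 0 t \<Longrightarrow> exp (- of_nat n * a w) + \<nu> * w ^ n * a w = v w"
proof -
  define a0 where "a0 = - Ln (v 0) / of_nat n"
  have a0: "exp (- of_nat n * a0) = v 0" using v0 n by (simp add: a0_def)
  define N where "N = (of_nat n :: complex)"
  have N: "N \<noteq> 0" using n by (simp add: N_def)
  define E where "E b = b + (exp (- N * b) - 1) / N" for b
  define c where "c w = \<nu> * w ^ n / (N * v 0)" for w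
  define T where "T w b = E b + c w * (a0 + b) - (v w - v 0) / (N * v 0)" for w b
  have "((\<lambda>b. 1 - exp (- N * b)) \<longlongrightarrow> 1 - exp (- N * 0)) (nhds 0)"
    by (intro tendsto_intros filterlim_ident)
  hence "((\<lambda>b. cmod (1 - exp (- N * b))) \<longlongrightarrow> 0) (nhds 0)"
    by (intro tendsto_norm_zero) simp
  hence "eventually (\<lambda>b. cmod (1 - exp (- N * b)) < 1 / 4) (nhds 0)"
    by (rule order_tendstoD(2)) simp
  then obtain \<rho>' where \<rho>': "\<rho>' > 0" "\<And>b. cmod b < \<rho>' \<Longrightarrow> cmod (1 - exp (- N * b)) < 1 / 4"
    unfolding eventually_nhds_metric by auto
  define \<rho> where "\<rho> = \<rho>' / 2"
  have \<rho>: "\<rho> > 0" "\<And>b. cmod b \<le> \<rho> \<Longrightarrow> cmod (1 - exp (- N * b)) \<le> 1 / 4"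
    using \<rho>' by (auto simp: \<rho>_def intro: less_imp_le)
  have E_lip: "cmod (E b - E b') \<le> 1 / 4 * cmod (b - b')" if "cmod b \<le> \<rho>" "cmod b' \<le> \<rho>" for b b'
  proof (rule field_differentiable_bound[of "cball 0 \<rho>" E "\<lambda>b. 1 - exp (- N * b)"])
    fix b :: complex assume "b \<in> cball 0 \<rho>"
    show "(E has_field_derivative 1 - exp (- N * b)) (at b within cball 0 \<rho>)"
      unfolding E_def using N by (auto intro!: derivative_eq_intros)
  qed (use that \<rho> in auto)
  have "isCont v 0"
    using v r by (intro field_differentiable_imp_continuous_at holomorphic_on_imp_differentiable_at[of _ "ball 0 r"]) auto
  hence vlim: "(v \<longlongrightarrow> v 0) (nhds 0)"
    by (simp add: continuous_at tendsto_nhds_iff)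
  have "(c \<longlongrightarrow> 0) (nhds 0)"
    unfolding c_def using N v0 n by (auto intro!: tendsto_eq_intros filterlim_ident)
  hence c_small: "eventually (\<lambda>w. cmod (c w) < 1 / 4) (nhds 0)"
    by (intro order_tendstoD) (auto intro!: tendsto_eq_intros)
  have "((\<lambda>w. T w 0) \<longlongrightarrow> 0) (nhds 0)"
    unfolding T_def E_def
    by (rule tendsto_eq_intros \<open>(c \<longlongrightarrow> 0) (nhds 0)\<close> vlim refl | use N v0 in simp)+
  hence T_small: "eventually (\<lambda>w. cmod (T w 0) < \<rho> / 2) (nhds 0)"
    using \<rho> by (intro order_tendstoD) (auto intro!: tendsto_eq_intros)
  obtain t' where t': "t' > 0" "\<And>w. cmod w < t' \<Longrightarrow> cmod (c w) < 1 / 4 \<and> cmod (T w 0) < \<rho> / 2"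
    using eventually_conj[OF c_small T_small] unfolding eventually_nhds_metric by auto
  define t where "t = min t' r"
  have t: "0 < t" "t \<le> r" using t' r by (auto simp: t_def)
  have hv: "v holomorphic_on ball 0 t"
    using v t by (auto intro: holomorphic_on_subset)
  obtain b where b: "b holomorphic_on ball 0 t" "\<And>w. w \<in> ball 0 t \<Longrightarrow> T w (b w) = b w"
  proof (rule holomorphic_fixed_point[of \<rho> t T])
    show "0 \<le> \<rho>" using \<rho> by simp
    show "(\<lambda>w. T w (f w)) holomorphic_on ball 0 t" if "f holomorphic_on ball 0 t" for f
      unfolding T_def E_def c_def using N v0 by (intro holomorphic_intros that hv) auto
    fix w :: complex assume w: "w \<in> ball 0 t"
    hence w': "cmod w < t'" by (simp add: t_def)
    show "cmod (T w 0) \<le> \<rho> / 2" using t'(2)[OF w'] by simp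
    fix b b' assume b: "cmod b \<le> \<rho>" "cmod b' \<le> \<rho>"
    have "cmod (T w b - T w b') = cmod ((E b - E b') + c w * (b - b'))"
      by (simp add: T_def algebra_simps)
    also have "\<dots> \<le> cmod (E b - E b') + cmod (c w) * cmod (b - b')"
      by (metis norm_mult norm_triangle_ineq)
    also have "\<dots> \<le> 1 / 4 * cmod (b - b') + 1 / 4 * cmod (b - b')"
      using E_lip[OF b] t'(2)[OF w'] by (intro add_mono mult_right_mono) auto
    finally show "cmod (T w b - T w b') \<le> cmod (b - b') / 2" by simp
  qed blast
  define a where "a = (\<lambda>w. a0 + b w)"
  have "exp (- of_nat n * a w) + \<nu> * w ^ n * a w = v w" if w: "w \<in> ball 0 t" for w
  proof -
    have "(exp (- N * b w) - 1) / N + c w * (a0 + b w) - (v w - v 0) / (N * v 0) = 0"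
      using b(2)[OF w] by (simp add: T_def E_def add_diff_eq)
    moreover have "N * v 0 * ((exp (- N * b w) - 1) / N + c w * (a0 + b w) - (v w - v 0) / (N * v 0)) =
        v 0 * (exp (- N * b w) - 1) + \<nu> * w ^ n * (a0 + b w) - (v w - v 0)"
      using N v0 by (simp add: c_def field_simps)
    ultimately have "v 0 * exp (- N * b w) + \<nu> * w ^ n * (a0 + b w) = v w"
      by (simp add: algebra_simps)
    moreover have "v 0 * exp (- N * b w) = exp (- N * (a0 + b w))"
      unfolding distrib_left exp_add using a0 by (simp add: N_def)
    ultimately show ?thesis by (simp add: a_def N_def)
  qed
  moreover have "a holomorphic_on ball 0 t" unfolding a_def by (intro holomorphic_intros b)
  ultimately show thesis using that t by blast
qed

section \<open>Existence of a normal form\<close>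

text \<open>If \<open>w\<^bsup>\<beta> + 1\<^esup> q\<close> is a primitive of the form \<open>w\<^sup>\<beta> u dw\<close>, then the coordinate with
\<open>z\<^bsup>\<beta> + 1\<^esup> = w\<^bsup>\<beta> + 1\<^esup> q\<close> works: \<open>q 0 \<noteq> 0\<close>, so that \<open>q\<close> has a holomorphic root near the origin.\<close>

lemma flat_density_form1:
  assumes u: "flat_density \<phi> \<beta> u r" and \<beta>: "\<beta> \<noteq> -1"
    and q: "q holomorphic_on ball 0 r" "\<And>w. w \<in> ball 0 r \<Longrightarrow> euler (of_real (\<beta> + 1)) q w = u w"
  shows "\<exists>\<epsilon> z. form1 \<phi> \<beta> \<epsilon> z"
proof -
  define \<gamma> where "\<gamma> = complex_of_real (\<beta> + 1)"
  have "\<beta> + 1 \<noteq> 0" using \<beta> by simp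
  hence \<gamma>: "\<gamma> \<noteq> 0" unfolding \<gamma>_def by (simp only: of_real_eq_0_iff not_False_eq_True)
  have r: "r > 0" and u0: "u 0 \<noteq> 0"
    and eq: "\<And>w. w \<in> ball 0 r - {0} \<Longrightarrow> exp (\<phi> w) = cmod w powr \<beta> * cmod (u w)"
    using u by (auto simp: flat_density_def)
  have q0: "q 0 \<noteq> 0" using q(2)[of 0] r u0 by (auto simp: euler_def)
  have "isCont q 0"
    using q r by (intro field_differentiable_imp_continuous_at holomorphic_on_imp_differentiable_at[of _ "ball 0 r"]) auto
  from continuous_at_avoid[OF this q0]
  obtain t' where t': "t' > 0" "\<And>w. dist 0 w < t' \<Longrightarrow> q w \<noteq> 0" by blast
  define t where "t = min t' r"
  have t: "0 < t" "t \<le> r" "\<And>w. w \<in> ball 0 t \<Longrightarrow> q w \<noteq> 0" using t' r by (auto simp: t_def)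
  have sub: "ball 0 t \<subseteq> ball (0::complex) r" using t by auto
  have hq: "q holomorphic_on ball 0 t" using q(1) sub holomorphic_on_subset by blast
  obtain g where g: "g holomorphic_on ball 0 t" "\<And>w. w \<in> ball 0 t \<Longrightarrow> exp (g w) = q w"
    using holomorphic_logarithm_exists[OF convex_ball open_ball hq t(3), of 0] t(1) by auto
  define a where "a = (\<lambda>w. g w / \<gamma>)"
  have a: "a holomorphic_on ball 0 t" unfolding a_def using \<gamma> by (intro holomorphic_intros g) auto
  have "form1_density \<beta> a w = u w" if w: "w \<in> ball 0 t" for w
  proof -
    have "form1_density \<beta> a w = euler \<gamma> (\<lambda>w. exp (\<gamma> * a w)) w"
      unfolding \<gamma>_def by (rule form1_density_eq_euler[OF a w])
    also have "\<dots> = euler \<gamma> q w"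
      by (rule euler_cong[OF _ w]) (use g \<gamma> in \<open>simp add: a_def\<close>)
    also have "\<dots> = u w" using q(2) w sub by (auto simp: \<gamma>_def)
    finally show ?thesis .
  qed
  hence "\<forall>w\<in>ball 0 t - {0}. exp (\<phi> w) = cmod w powr \<beta> * cmod (form1_density \<beta> a w)"
    using eq t(2) by auto
  thus ?thesis by (rule density_imp_form1[OF \<beta> a t(1)])
qed

text \<open>Here \<open>dz / z = (1 + w a') dw / w\<close>, and \<open>1 + w a' = u / u 0\<close> can be solved for \<open>a\<close>.\<close>

lemma flat_density_form2:
  assumes u: "flat_density \<phi> (-1) u r"
  shows "\<exists>c \<epsilon> z. form2 \<phi> c \<epsilon> z"
proof -
  have r: "r > 0" and u0: "u 0 \<noteq> 0" and hol: "u holomorphic_on ball 0 r"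
    and eq: "\<And>w. w \<in> ball 0 r - {0} \<Longrightarrow> exp (\<phi> w) = cmod w powr (-1) * cmod (u w)"
    using u by (auto simp: flat_density_def)
  define h where "h = (\<lambda>w. u w / u 0 - 1)"
  have h: "h holomorphic_on ball 0 r" unfolding h_def using u0 by (intro holomorphic_intros hol) auto
  have "fps_nth (fps_expansion h 0) 0 = 0" using u0 by (simp add: fps_expansion_def h_def)
  then obtain a where a: "a holomorphic_on ball 0 r" "\<And>w. w \<in> ball 0 r \<Longrightarrow> euler 0 a w = h w"
    using euler_solvable[OF h r, of 0] by auto
  have "cmod (form2_density (cmod (u 0)) a w) = cmod (u w)" if "w \<in> ball 0 r" for w
  proof -
    have "w * deriv a w = u w / u 0 - 1" using a(2)[OF that] by (simp add: euler_def h_def)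
    thus ?thesis using u0 by (simp add: form2_density_def norm_mult norm_divide)
  qed
  hence "\<forall>w\<in>ball 0 r - {0}. exp (\<phi> w) = cmod w powr (-1) * cmod (form2_density (cmod (u 0)) a w)"
    using eq by auto
  moreover have "cmod (u 0) > 0" using u0 by simp
  ultimately show ?thesis using density_imp_form2[OF _ a(1) r] by blast
qed

text \<open>After multiplication by a unimodular \<open>l\<close>, the residue is \<open>\<nu> > 0\<close>. The rest of the form has a primitive
\<open>w\<^bsup>-n\<^esup> v\<close>, and \<open>a\<close> has to satisfy \<open>e\<^bsup>-n a\<^esup> + \<nu> w\<^sup>n a = v\<close>, by comparison with the primitive of the
normal form.\<close>

lemma flat_density_form3:
  assumes u: "flat_density \<phi> (- real n - 1) u r" and n: "n \<ge> 1"
    and res: "fps_nth (fps_expansion u 0) n \<noteq> 0"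
  shows "\<exists>\<nu> \<epsilon> z. form3 \<phi> \<nu> n \<epsilon> z"
proof -
  have r: "r > 0" and u0: "u 0 \<noteq> 0" and hol: "u holomorphic_on ball 0 r"
    and eq: "\<And>w. w \<in> ball 0 r - {0} \<Longrightarrow> exp (\<phi> w) = cmod w powr (- real n - 1) * cmod (u w)"
    using u by (auto simp: flat_density_def)
  define R where "R = fps_nth (fps_expansion u 0) n"
  define \<nu> where "\<nu> = cmod R"
  define l where "l = of_real \<nu> / R"
  have R: "R \<noteq> 0" using res by (simp add: R_def)
  have \<nu>: "\<nu> > 0" and l: "cmod l = 1" "l * R = of_real \<nu>" "l \<noteq> 0"
    using R by (auto simp: \<nu>_def l_def norm_divide)
  define h where "h = (\<lambda>w. l * u w - of_real \<nu> * w ^ n)"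
  have h: "h holomorphic_on ball 0 r" unfolding h_def by (intro holomorphic_intros hol)
  have "fps_expansion h 0 = fps_const l * fps_expansion u 0 - fps_const (of_real \<nu>) * fps_X ^ n"
    unfolding h_def
    by (intro fps_expansion_eqI fps_expansion_intros holomorphic_has_fps_expansion_ball[OF hol r])
  hence "fps_nth (fps_expansion h 0) n = 0" using l(2) by (simp add: R_def)
  moreover have "k = n" if "- of_nat n + of_nat k = (0 :: complex)" for k
    using that by (simp add: add_eq_0_iff2)
  ultimately obtain v where v: "v holomorphic_on ball 0 r"
      "\<And>w. w \<in> ball 0 r \<Longrightarrow> euler (- of_nat n) v w = h w"
    using euler_solvable[OF h r, of "- of_nat n"] by metis
  have "- of_nat n * v 0 = l * u 0" using v(2)[of 0] r n by (simp add: euler_def h_def zero_power)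
  hence v0: "v 0 \<noteq> 0" using l(3) u0 by auto
  obtain a t where t: "0 < t" "t \<le> r" and a: "a holomorphic_on ball 0 t"
    "\<And>w. w \<in> ball 0 t \<Longrightarrow> exp (- of_nat n * a w) + of_real \<nu> * w ^ n * a w = v w"
    using holomorphic_exp_implicit[OF v(1) r v0 n] by metis
  have sub: "ball 0 t \<subseteq> ball (0::complex) r" using t by auto
  have "cmod (form3_density \<nu> n a w) = cmod (u w)" if w: "w \<in> ball 0 t" for w
  proof -
    have "form3_density \<nu> n a w = of_real \<nu> * w ^ n + euler (- of_nat n) v w"
      unfolding form3_density_eq_euler[OF a(1) w n] using euler_cong[OF a(2) w] by simp
    also have "\<dots> = l * u w" using v(2) w sub by (auto simp: h_def)
    finally show ?thesis using l(1) by (simp add: norm_mult)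
  qed
  hence "\<forall>w\<in>ball 0 t - {0}. exp (\<phi> w) = cmod w powr (- real n - 1) * cmod (form3_density \<nu> n a w)"
    using eq t(2) by auto
  thus ?thesis using density_imp_form3[OF \<nu> n a(1) t(1)] by blast
qed

lemma flat_density_normal_form:
  assumes u: "flat_density \<phi> s u r"
  shows "\<exists>\<epsilon> z. (\<exists>\<beta>. form1 \<phi> \<beta> \<epsilon> z) \<or> (\<exists>c. form2 \<phi> c \<epsilon> z) \<or> (\<exists>\<nu> n. form3 \<phi> \<nu> n \<epsilon> z)"
proof -
  have r: "r > 0" and hol: "u holomorphic_on ball 0 r" using u by (auto simp: flat_density_def)
  define \<gamma> where "\<gamma> = complex_of_real (s + 1)"
  consider "s = -1" | "s \<noteq> -1" "\<And>k. \<gamma> + of_nat k = 0 \<Longrightarrow> fps_nth (fps_expansion u 0) k = 0"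
    | k where "s \<noteq> -1" "\<gamma> + of_nat k = 0" "fps_nth (fps_expansion u 0) k \<noteq> 0"
    by blast
  thus ?thesis
  proof cases
    case 1
    thus ?thesis using flat_density_form2 u by blast
  next
    case 2
    obtain q where "q holomorphic_on ball 0 r" "\<And>w. w \<in> ball 0 r \<Longrightarrow> euler \<gamma> q w = u w"
      using euler_solvable[OF hol r 2(2)] by blast
    thus ?thesis using flat_density_form1[OF u 2(1)] unfolding \<gamma>_def by blast
  next
    case (3 n)
    have "complex_of_real (s + 1 + real n) = 0" using 3(2) by (simp add: \<gamma>_def)
    hence "s + 1 + real n = 0" by (simp only: of_real_eq_0_iff)
    hence s: "s = - real n - 1" by simp
    have "n \<ge> 1" using s 3(1) by (cases n) auto
    thus ?thesis using flat_density_form3[of \<phi> n u r] u s 3(3) by blast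
  qed
qed

theorem theorem1p2:
  fixes \<phi> :: "complex \<Rightarrow> real" and R M N :: real
  assumes metric: "conformal_metric \<phi>"
    and flat: "\<forall>w\<in>punctured_disk. gauss_curvature \<phi> w = 0"
    and params: "0 < R" "R < 1" "M > 0" "N \<ge> 0"
    and growth: "\<forall>r>1/R. area \<phi> (annulus (1/r) R) \<le> ennreal (M * r powr N)"
  shows
    "(\<exists>\<epsilon> z. (\<exists>\<beta>. form1 \<phi> \<beta> \<epsilon> z) \<or> (\<exists>c. form2 \<phi> c \<epsilon> z) \<or> (\<exists>\<nu> n. form3 \<phi> \<nu> n \<epsilon> z))
   \<and> (\<forall>\<beta> \<beta>' \<epsilon> \<epsilon>' z z'. form1 \<phi> \<beta> \<epsilon> z \<and> form1 \<phi> \<beta>' \<epsilon>' z' \<longrightarrow> \<beta>' = \<beta>)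
   \<and> (\<forall>c c' \<epsilon> \<epsilon>' z z'. form2 \<phi> c \<epsilon> z \<and> form2 \<phi> c' \<epsilon>' z' \<longrightarrow> c' = c)
   \<and> (\<forall>\<nu> \<nu>' n n' \<epsilon> \<epsilon>' z z'. form3 \<phi> \<nu> n \<epsilon> z \<and> form3 \<phi> \<nu>' n' \<epsilon>' z' \<longrightarrow> n' = n \<and> \<nu>' = \<nu>)
   \<and> (\<forall>\<beta> \<epsilon> z. \<beta> \<in> ({..< -1} - \<int>) \<union> {-1 <..} \<and> form1 \<phi> \<beta> \<epsilon> z \<longrightarrow>
        (\<forall>l. cmod l = 1 \<longrightarrow> form1 \<phi> \<beta> \<epsilon> (\<lambda>w. l * z w)) \<and>
        (\<forall>\<epsilon>' z'. form1 \<phi> \<beta> \<epsilon>' z' \<longrightarrow>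
           (\<exists>l. cmod l = 1 \<and> (\<forall>w\<in>ball 0 (min \<epsilon> \<epsilon>'). z' w = l * z w))))
   \<and> (\<forall>c \<epsilon> z. form2 \<phi> c \<epsilon> z \<longrightarrow>
        (\<forall>p. p \<noteq> 0 \<longrightarrow> form2 \<phi> c \<epsilon> (\<lambda>w. p * z w)) \<and>
        (\<forall>\<epsilon>' z'. form2 \<phi> c \<epsilon>' z' \<longrightarrow>
           (\<exists>p. p \<noteq> 0 \<and> (\<forall>w\<in>ball 0 (min \<epsilon> \<epsilon>'). z' w = p * z w))))"
proof (intro conjI)
  have "Ck 0 \<phi> punctured_disk"
    using metric unfolding conformal_metric_def smooth_def by blast
  hence cont: "continuous_on punctured_disk \<phi>" by simp
  obtain \<kappa> U where U: "U holomorphic_on punctured_disk"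
      "\<And>w. w \<in> punctured_disk \<Longrightarrow> exp (\<phi> w) = cmod w powr \<kappa> * cmod (U w)"
    using flat_metric_modulus[OF metric flat] by blast
  obtain m :: nat and B where
    "\<And>w. 0 < cmod w \<Longrightarrow> cmod w < R / 2 \<Longrightarrow> cmod (w ^ m * U w) \<le> B"
    using area_growth_imp_bounded[OF U cont params(1-3) growth] by blast
  hence "\<exists>s u r. flat_density \<phi> s u r"
    using params(1) by (intro bounded_modulus_imp_flat_density[OF U, of "R / 2"]) auto
  thus "\<exists>\<epsilon> z. (\<exists>\<beta>. form1 \<phi> \<beta> \<epsilon> z) \<or> (\<exists>c. form2 \<phi> c \<epsilon> z) \<or> (\<exists>\<nu> n. form3 \<phi> \<nu> n \<epsilon> z)"
    using flat_density_normal_form by blast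
qed (blast dest: form1_exponent_unique form2_constant_unique form3_constants_unique
      intro: form1_rotate form2_scale form1_coordinate_unique form2_coordinate_unique)+

end
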